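(* Algorithm RVM (described in the context) guarantees rendezvous at cost $D$ for any two agents with a map, in any terrain without obstacles. Here $D$ is the distance between the starting positions of the agents in the terrain.
   Context: A terrain without obstacles is a closed polygon $\mathcal{P}_0$ in the plane. The distance between two points of the terrain is the length of a shortest path between them included in the terrain; in a polygon without obstacles this shortest path is unique. Agents: two agents, modeled as points, start at different points of the terrain chosen by the adversary. Each has a unit of length and a compass (a direction called North); both use the same clockwise orientation. The compasses may be incoherent, i.e., the agents may have different Norths. An agent knows whether it is at an interior or a boundary point, and in the latter case the slope(s) of the boundary there; it cannot sense the terrain or the other agent in any vicinity of its location. A map available to an agent shows the terrain to scale, marks the starting positions of this agent and of the other agent, and is oriented according to the agent's own compass. The agents may be anonymous, i.e., they execute identical algorithms. Routes: an agent constructs a finite polygonal path in the terrain (its route) in steps. In a step starting at a point, the agent chooses a direction (according to its compass) and a distance; if the segment of this length in this direction does not intersect the boundary, the step ends at the end of this segment, otherwise it ends at the closest boundary point in this direction. If the starting point of the step is on a segment of the boundary, the agent may alternatively follow this segment in either direction until its end or for a given distance. Walks: let the route be $(S_1,\dots,S_k)$ with $S_i=[a_i,a_{i+1}]$. The adversary chooses reals $0=t_1<t_2<\dots<t_{k+1}$ and continuous functions $f_i:[t_i,t_{i+1}]\to[a_i,a_{i+1}]$ with $f_i(t_i)=a_i$, $f_i(t_{i+1})=a_{i+1}$; the walk is $f(t)=f_i(t)$ for $t\in[t_i,t_{i+1}]$, and the agent is inert after $t_{k+1}$. Agents with walks $f_1,f_2$ meet (rendezvous) at time $t$ if $f_1(t)=f_2(t)$.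 Rendezvous is guaranteed if the agents meet at some time regardless of the walks chosen by the adversary. The trajectory of an agent is the sequence of segments of its route until rendezvous (the last one possibly being a portion of a route segment). The cost of an algorithm is the worst-case sum of the lengths of the segments of the trajectories of both agents, the worst case being taken over all terrains with the considered values of parameters and all adversarial decisions. Algorithm RVM: The agent computes the (unique) shortest path between the starting positions of the two agents. Then it moves along this shortest path until the middle of it. *)

theory Defs
  imports "HOL-Analysis.Analysis"
begin

section \<open>Terrains\<close>

fun polygonal_path :: "complex list \<Rightarrow> real \<Rightarrow> complex" where
  "polygonal_path [] = linepath 0 0"
| "polygonal_path [a] = linepath a a"
| "polygonal_path [a, b] = linepath a b"
| "polygonal_path (a # b # c # vs) = linepath a b +++ polygonal_path (b # c # vs)"

text \<open>A terrain without obstacles: the closed region bounded by a simple closed polygonal curve.\<close>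

definition terrain :: "complex set \<Rightarrow> bool" where
  "terrain P \<longleftrightarrow>
     (\<exists>vs. length vs \<ge> 3 \<and> simple_path (polygonal_path (vs @ [hd vs])) \<and>
           P = path_image (polygonal_path (vs @ [hd vs])) \<union>
               inside (path_image (polygonal_path (vs @ [hd vs]))))"

section \<open>Lengths and shortest paths\<close>

definition path_length :: "(real \<Rightarrow> complex) \<Rightarrow> ennreal" where
  "path_length g =
     (SUP ts \<in> {ts. sorted ts \<and> set ts \<subseteq> {0..1}}.
        \<Sum>i<length ts - 1. ennreal (dist (g (ts ! i)) (g (ts ! Suc i))))"

definition path_within :: "complex set \<Rightarrow> complex \<Rightarrow> complex \<Rightarrow> (real \<Rightarrow> complex) \<Rightarrow> bool" where
  "path_within P x y g \<longleftrightarrow>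
     path g \<and> path_image g \<subseteq> P \<and> pathstart g = x \<and> pathfinish g = y"

definition shortest_path :: "complex set \<Rightarrow> complex \<Rightarrow> complex \<Rightarrow> (real \<Rightarrow> complex) \<Rightarrow> bool" where
  "shortest_path P x y g \<longleftrightarrow>
     path_within P x y g \<and> (\<forall>h. path_within P x y h \<longrightarrow> path_length g \<le> path_length h)"

definition terrain_dist :: "complex set \<Rightarrow> complex \<Rightarrow> complex \<Rightarrow> ennreal" where
  "terrain_dist P x y = path_length (SOME g. shortest_path P x y g)"

section \<open>Steps and routes\<close>

text \<open>The argument of an instruction is the displacement aimed at (direction and distance
  together), in the coordinates of the agent.\<close>

datatype instruction = Go complex | Follow complex

text \<open>Move from \<open>a\<close> towards \<open>a + v\<close> for as long as the points strictly between \<open>a\<close> and the current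
  position lie in \<open>A\<close>.\<close>

definition advance :: "complex set \<Rightarrow> complex \<Rightarrow> complex \<Rightarrow> complex" where
  "advance A a v = a + Sup {r \<in> {0..1}. open_segment a (a + r *\<^sub>R v) \<subseteq> A} *\<^sub>R v"

text \<open>The number \<open>c\<close> is the plane vector that the agent regards as one unit to the North; its
  argument is the compass and its modulus the unit of length.  Going stops at the end of the
  given segment or at the first boundary point ahead; on a boundary point, going outwards is no
  move at all.  Following stops after the given distance or at the end of the boundary segment;
  away from the boundary, or in a direction not tangent to it, it is no move at all.\<close>

fun step :: "complex set \<Rightarrow> complex \<Rightarrow> complex \<Rightarrow> instruction \<Rightarrow> complex" where
  "step P c a (Go v) = advance (interior P) a (c * v)"
| "step P c a (Follow v) = advance (frontier P) a (c * v)"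

fun route :: "complex set \<Rightarrow> complex \<Rightarrow> complex \<Rightarrow> instruction list \<Rightarrow> complex list" where
  "route P c a [] = [a]"
| "route P c a (s # ss) = a # route P c (step P c a s) ss"

section \<open>Agents with a map\<close>

record agent_map =
  chart :: "complex set"
  own :: complex
  other :: complex

text \<open>The map of an agent that starts at \<open>p\<close>, the other agent starting at \<open>q\<close>: the terrain in the
  coordinates of the agent, with origin at \<open>p\<close>.  Multiplication by a complex number preserves
  orientation, so all agents agree on what is clockwise.\<close>

definition map_view :: "complex set \<Rightarrow> complex \<Rightarrow> complex \<Rightarrow> complex \<Rightarrow> agent_map" where
  "map_view P c p q =
     (let \<phi> = (\<lambda>z. (z - p) / c) in \<lparr>chart = \<phi> ` P, own = \<phi> p, other = \<phi> q\<rparr>)"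

text \<open>An algorithm receives only the map; in particular it cannot tell the two agents apart.\<close>

type_synonym algorithm = "agent_map \<Rightarrow> instruction list"

definition agent_route ::
    "algorithm \<Rightarrow> complex set \<Rightarrow> complex \<Rightarrow> complex \<Rightarrow> complex \<Rightarrow> complex list" where
  "agent_route A P c p q = route P c p (A (map_view P c p q))"

section \<open>Walks and rendezvous\<close>

text \<open>Indices are shifted by one: the segments of \<open>vs\<close> are \<open>[vs ! i, vs ! Suc i]\<close> with
  \<open>i < length vs - 1\<close>, and \<open>[t i, t (Suc i)]\<close> is the time interval the adversary assigns to
  segment \<open>i\<close>.\<close>

definition walk :: "complex list \<Rightarrow> (nat \<Rightarrow> real) \<Rightarrow> (real \<Rightarrow> complex) \<Rightarrow> bool" where
  "walk vs t f \<longleftrightarrow>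
     t 0 = 0 \<and>
     (\<forall>i < length vs - 1.
        t i < t (Suc i) \<and> continuous_on {t i..t (Suc i)} f \<and>
        f ` {t i..t (Suc i)} \<subseteq> closed_segment (vs ! i) (vs ! Suc i) \<and>
        f (t i) = vs ! i \<and> f (t (Suc i)) = vs ! Suc i) \<and>
     (\<forall>s \<ge> t (length vs - 1). f s = last vs)"

definition meet_at :: "(real \<Rightarrow> complex) \<Rightarrow> (real \<Rightarrow> complex) \<Rightarrow> real \<Rightarrow> bool" where
  "meet_at f1 f2 T \<longleftrightarrow> T \<ge> 0 \<and> f1 T = f2 T"

definition rendezvous_at :: "(real \<Rightarrow> complex) \<Rightarrow> (real \<Rightarrow> complex) \<Rightarrow> real \<Rightarrow> bool" where
  "rendezvous_at f1 f2 T \<longleftrightarrow> meet_at f1 f2 T \<and> (\<forall>s < T. \<not> meet_at f1 f2 s)"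

text \<open>Length of the trajectory up to time \<open>T\<close>.  The part of segment \<open>i\<close> visited by then is the
  image below: the whole segment, an initial portion of it, or empty.  Its length is its diameter.\<close>

definition trajectory_length ::
    "complex list \<Rightarrow> (nat \<Rightarrow> real) \<Rightarrow> (real \<Rightarrow> complex) \<Rightarrow> real \<Rightarrow> real" where
  "trajectory_length vs t f T =
     (\<Sum>i<length vs - 1. diameter (f ` {t i..min (t (Suc i)) T}))"

definition initial_positions :: "complex set \<Rightarrow> complex \<Rightarrow> complex \<Rightarrow> bool" where
  "initial_positions P p q \<longleftrightarrow> terrain P \<and> p \<in> P \<and> q \<in> P \<and> p \<noteq> q"

text \<open>Compasses, units of length and walks, as chosen by the adversary.\<close>

definition adversary_choice ::
    "algorithm \<Rightarrow> complex set \<Rightarrow> complex \<Rightarrow> complex \<Rightarrow> complex \<Rightarrow> complex \<Rightarrow>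
     (nat \<Rightarrow> real) \<Rightarrow> (real \<Rightarrow> complex) \<Rightarrow> (nat \<Rightarrow> real) \<Rightarrow> (real \<Rightarrow> complex) \<Rightarrow> bool" where
  "adversary_choice A P p q c1 c2 t1 f1 t2 f2 \<longleftrightarrow>
     c1 \<noteq> 0 \<and> c2 \<noteq> 0 \<and>
     walk (agent_route A P c1 p q) t1 f1 \<and> walk (agent_route A P c2 q p) t2 f2"

definition guarantees_rendezvous ::
    "algorithm \<Rightarrow> complex set \<Rightarrow> complex \<Rightarrow> complex \<Rightarrow> bool" where
  "guarantees_rendezvous A P p q \<longleftrightarrow>
     (\<forall>c1 c2 t1 f1 t2 f2. adversary_choice A P p q c1 c2 t1 f1 t2 f2 \<longrightarrow> (\<exists>T. meet_at f1 f2 T))"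

text \<open>Worst case over all terrains and starting positions at distance \<open>D\<close>, and over all
  choices of the adversary.\<close>

definition cost :: "algorithm \<Rightarrow> ennreal \<Rightarrow> ennreal" where
  "cost A D =
     Sup {ennreal (trajectory_length (agent_route A P c1 p q) t1 f1 T +
                   trajectory_length (agent_route A P c2 q p) t2 f2 T)
          | P p q c1 c2 t1 f1 t2 f2 T.
            initial_positions P p q \<and> terrain_dist P p q = D \<and>
            adversary_choice A P p q c1 c2 t1 f1 t2 f2 \<and> rendezvous_at f1 f2 T}"

section \<open>Algorithm RVM\<close>

text \<open>The polygonal path with vertices \<open>vs\<close> runs along \<open>g\<close> from its start to \<open>g u\<close>; segment \<open>i\<close> is
  the part of \<open>g\<close> between parameters \<open>\<tau> i\<close> and \<open>\<tau> (Suc i)\<close>.\<close>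

definition runs_along :: "complex list \<Rightarrow> (real \<Rightarrow> complex) \<Rightarrow> real \<Rightarrow> bool" where
  "runs_along vs g u \<longleftrightarrow>
     (\<exists>\<tau>. \<tau> 0 = 0 \<and> \<tau> (length vs - 1) = u \<and>
        (\<forall>i < length vs. g (\<tau> i) = vs ! i) \<and>
        (\<forall>i < length vs - 1.
           \<tau> i \<le> \<tau> (Suc i) \<and>
           g ` {\<tau> i..\<tau> (Suc i)} = closed_segment (vs ! i) (vs ! Suc i)))"

text \<open>The agent works out its steps on the map, where its own unit to the North is \<open>1\<close>.  The
  choice of \<open>g\<close> is one of parametrization only, shortest paths in a polygon being unique; that of
  the instructions is one of subdivision.\<close>

definition RVM :: algorithm where
  "RVM m =
     (let g = (SOME g. shortest_path (chart m) (own m) (other m) g)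
      in SOME ss. \<exists>u \<in> {0..1}.
           path_length (subpath 0 u g) = path_length g / 2 \<and>
           runs_along (route (chart m) 1 (own m) ss) g u)"

end

(* Uniqueness of shortest paths: if the images of two shortest paths were different, Janiszewski's
   theorem would give a point enclosed by their union, hence lying in the terrain.  The directions
   in which it sees the first and the second path cover the unit circle, so by connectedness some
   chord of the terrain through this point has both ends on the same path.  This path contains the
   chord, which is absurd.  Hence both agents head for the same midpoint.  The agents can execute
   this plan because the terrain is starlike around each of its points, with the open rays near the
   point entirely interior or entirely on the boundary; compactness of [0, 1] splits a shortest
   path into finitely many such pieces.  Each trajectory has length at most D/2, and at a
   meeting the two together connect the starting positions within the terrain, so their total
   length is exactly D. *)

theory Submission
  imports Defs "HOL-Complex_Analysis.Great_Picard"
begin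

section \<open>Arc length\<close>

text \<open>The agents choose their shortest paths independently, in differently rotated and scaled
  charts and in opposite directions, so nothing but minimality relates the two. Parametrizations may
  pause; hence uniqueness concerns images, and midpoints are located by distance along the path. A
  chord with both ends on one path is absurd because the enclosed point lies on neither path. Once
  nothing is enclosed, the complement of the union is connected, so the images have a connected
  intersection containing both starting positions, and no proper connected subset of a shortest path
  contains both of its ends. The dichotomy between interior and boundary is dictated by the
  instructions: going uses interior points only, following uses boundary points only. Lengths live
  in \<open>ennreal\<close>, so their finiteness has to be established before they can be cancelled.
  Finally, \<open>cost\<close> is a supremum: besides the equality for every run, an actual run has
  to be exhibited.\<close>

fun polyline_length :: "complex list \<Rightarrow> ennreal" where
  "polyline_length (x # y # zs) = ennreal (dist x y) + polyline_length (y # zs)"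
| "polyline_length _ = 0"

lemma polyline_length_conv_sum:
  "polyline_length xs = (\<Sum>i<length xs - 1. ennreal (dist (xs ! i) (xs ! Suc i)))"
proof (induction xs rule: polyline_length.induct)
  case (1 x y zs)
  show ?case
    using 1 by (simp add: sum.lessThan_Suc_shift del: sum_ennreal sum.lessThan_Suc)
qed auto

lemma polyline_length_append:
  "polyline_length (xs @ x # ys) = polyline_length (xs @ [x]) + polyline_length (x # ys)"
proof (induction xs rule: polyline_length.induct)
  case (1 a b zs)
  then show ?case by (simp add: add.assoc)
qed (auto simp: add.assoc)

text \<open>The triangle inequality at the junction of the two lists. It permits any partition to be
  cut at a prescribed parameter when arc lengths are added.\<close>

lemma polyline_length_insert:
  "polyline_length (xs @ ys) \<le> polyline_length (xs @ [x]) + polyline_length (x # ys)"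
proof (cases "xs = [] \<or> ys = []")
  case True
  then show ?thesis
  proof
    assume "xs = []"
    then show ?thesis by (cases ys) auto
  next
    assume ys: "ys = []"
    show ?thesis
    proof (cases xs rule: rev_cases)
      case (snoc us u)
      then show ?thesis
        using ys polyline_length_append[of us u "[x]"] by simp
    qed (use ys in auto)
  qed
next
  case False
  then obtain us u v vs where xs: "xs = us @ [u]" and ys: "ys = v # vs"
    by (metis list.exhaust rev_exhaust)
  have "ennreal (dist u v) \<le> ennreal (dist u x) + ennreal (dist x v)"
    by (simp flip: ennreal_plus add: dist_triangle)
  then have "ennreal (dist u v) + polyline_length (v # vs)
      \<le> ennreal (dist u x) + (ennreal (dist x v) + polyline_length (v # vs))"
    using add_right_mono by (fastforce simp: add.assoc)
  then show ?thesis
    using xs ys polyline_length_append[of us u "v # vs"] polyline_length_append[of us u "[x]"]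
    by (simp add: add.assoc add_left_mono)
qed

lemma polyline_length_rev: "polyline_length (rev xs) = polyline_length xs"
proof (induction xs rule: polyline_length.induct)
  case (1 x y zs)
  have "polyline_length (rev (x # y # zs)) = polyline_length (rev zs @ y # [x])"
    by simp
  also have "\<dots> = polyline_length (rev (y # zs)) + ennreal (dist y x)"
    by (subst polyline_length_append) simp
  finally show ?case
    using 1 by (simp add: dist_commute add.commute)
qed auto

text \<open>Keeping the interval as an argument avoids reparametrizing subpaths to the unit
  interval. Partitions need not contain the end points of the interval and may repeat parameters, so
  images of partitions under monotone maps are again partitions.\<close>

definition arc_length :: "(real \<Rightarrow> complex) \<Rightarrow> real \<Rightarrow> real \<Rightarrow> ennreal" where
  "arc_length g a b =
     (SUP ts \<in> {ts. sorted ts \<and> set ts \<subseteq> {a..b}}. polyline_length (map g ts))"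

lemma path_length_eq_arc_length: "path_length g = arc_length g 0 1"
  unfolding path_length_def arc_length_def
  by (intro SUP_cong refl) (auto simp: polyline_length_conv_sum intro!: sum.cong)

lemma polyline_length_le_arc_length:
  "sorted ts \<Longrightarrow> set ts \<subseteq> {a..b} \<Longrightarrow> polyline_length (map g ts) \<le> arc_length g a b"
  unfolding arc_length_def by (rule SUP_upper) auto

lemma arc_length_leI:
  assumes "\<And>ts. sorted ts \<Longrightarrow> set ts \<subseteq> {a..b} \<Longrightarrow> polyline_length (map g ts) \<le> B"
  shows "arc_length g a b \<le> B"
  unfolding arc_length_def using assms by (intro SUP_least) auto

lemma arc_length_mono:
  "a' \<le> a \<Longrightarrow> b \<le> b' \<Longrightarrow> arc_length g a b \<le> arc_length g a' b'"
  by (intro arc_length_leI polyline_length_le_arc_length) auto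

lemma dist_le_arc_length: "a \<le> b \<Longrightarrow> ennreal (dist (g a) (g b)) \<le> arc_length g a b"
  using polyline_length_le_arc_length[of "[a, b]" a b g] by simp

lemma arc_length_cong:
  assumes "\<And>x. a \<le> x \<Longrightarrow> x \<le> b \<Longrightarrow> g x = h x"
  shows "arc_length g a b = arc_length h a b"
  unfolding arc_length_def using assms
  by (intro SUP_cong refl arg_cong[where f = polyline_length]) auto

lemma arc_length_compose_mono:
  assumes "mono_on {a..b} f"
  shows "arc_length (g \<circ> f) a b \<le> arc_length g (f a) (f b)"
proof (rule arc_length_leI)
  fix ts assume ts: "sorted ts" "set ts \<subseteq> {a..b}"
  then have "sorted (map f ts)"
    using assms by (induction ts) (auto simp: mono_on_def)
  moreover have "set (map f ts) \<subseteq> {f a..f b}"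
    using ts assms by (force simp: mono_on_def)
  ultimately show "polyline_length (map (g \<circ> f) ts) \<le> arc_length g (f a) (f b)"
    using polyline_length_le_arc_length[of "map f ts"] by simp
qed

lemma arc_length_const: "arc_length (\<lambda>_. x) a b = 0"
proof -
  have "polyline_length (map (\<lambda>_. x) ts) = 0" for ts :: "real list"
    by (induction ts rule: induct_list012) auto
  then have "arc_length (\<lambda>_. x) a b \<le> 0"
    by (intro arc_length_leI) auto
  then show ?thesis by simp
qed

lemma arc_length_refl: "arc_length g a a = 0"
  using arc_length_cong[of a a g "\<lambda>_. g a"] by (simp add: arc_length_const)

text \<open>The comparison for monotone substitutions is applied to the affine map and to its
  inverse.\<close>

lemma arc_length_affine:
  assumes "m > 0"
  shows "arc_length (\<lambda>x. g (m * x + c)) a b = arc_length g (m * a + c) (m * b + c)"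
proof (rule antisym)
  show "arc_length (\<lambda>x. g (m * x + c)) a b \<le> arc_length g (m * a + c) (m * b + c)"
    using arc_length_compose_mono[of a b "\<lambda>x. m * x + c" g] assms
    by (simp add: o_def mono_on_def)
  have "arc_length ((\<lambda>x. g (m * x + c)) \<circ> (\<lambda>y. (y - c) / m)) (m * a + c) (m * b + c)
      \<le> arc_length (\<lambda>x. g (m * x + c)) ((m * a + c - c) / m) ((m * b + c - c) / m)"
    using assms by (intro arc_length_compose_mono) (auto simp: mono_on_def divide_right_mono)
  then show "arc_length g (m * a + c) (m * b + c) \<le> arc_length (\<lambda>x. g (m * x + c)) a b"
    using assms by (simp add: o_def)
qed

lemma path_length_subpath:
  assumes "u \<le> v"
  shows "path_length (subpath u v g) = arc_length g u v"
proof (cases "u = v")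
  case True
  then show ?thesis
    by (simp add: path_length_eq_arc_length arc_length_refl arc_length_const subpath_def)
next
  case False
  then show ?thesis
    using assms arc_length_affine[of "v - u" g u 0 1]
    by (simp add: path_length_eq_arc_length subpath_def)
qed

text \<open>For one inequality a partition is cut at \<open>b\<close>; for the other, partitions of
  the two halves are joined through \<open>b\<close>, and the suprema over the two halves are taken
  one after the other.\<close>

lemma arc_length_add:
  assumes "a \<le> b" "b \<le> c"
  shows "arc_length g a c = arc_length g a b + arc_length g b c"
proof (rule antisym)
  show "arc_length g a c \<le> arc_length g a b + arc_length g b c"
  proof (rule arc_length_leI)
    fix ts assume ts: "sorted ts" "set ts \<subseteq> {a..c}"
    define us vs where "us = takeWhile (\<lambda>t. t \<le> b) ts" and "vs = dropWhile (\<lambda>t. t \<le> b) ts"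
    have eq: "ts = us @ vs"
      by (simp add: us_def vs_def)
    have sorted: "sorted us" "sorted vs"
      using ts(1) unfolding eq sorted_append by auto
    have us: "set us \<subseteq> {a..b}"
    proof
      fix x assume "x \<in> set us"
      then show "x \<in> {a..b}"
        using ts(2) unfolding us_def by (metis atLeastAtMost_iff set_takeWhileD subsetD)
    qed
    have vs: "set vs \<subseteq> {b..c}"
    proof (cases vs)
      case (Cons w ws)
      then have "\<not> w \<le> b"
        by (metis dropWhile_eq_Cons_conv vs_def)
      moreover have "set vs \<subseteq> {a..c}"
        using ts(2) unfolding eq by simp
      ultimately show ?thesis
        using Cons sorted(2) by fastforce
    qed simp
    have "polyline_length (map g ts) \<le> polyline_length (map g (us @ [b])) + polyline_length (map g (b # vs))"
      using polyline_length_insert[of "map g us" "map g vs" "g b"] eq by simp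
    also have "\<dots> \<le> arc_length g a b + arc_length g b c"
      using sorted us vs assms
      by (intro add_mono polyline_length_le_arc_length) (auto simp: sorted_append)
    finally show "polyline_length (map g ts) \<le> arc_length g a b + arc_length g b c" .
  qed
next
  have key: "polyline_length (map g us) + polyline_length (map g vs) \<le> arc_length g a c"
    if "sorted us" "set us \<subseteq> {a..b}" "sorted vs" "set vs \<subseteq> {b..c}" for us vs
  proof -
    have "polyline_length (map g us) \<le> polyline_length (map g us @ [g b])"
      by (cases us rule: rev_cases) (auto simp: polyline_length_append[of _ _ "[g b]"])
    moreover have "polyline_length (map g vs) \<le> polyline_length (g b # map g vs)"
      by (cases vs) auto
    ultimately have "polyline_length (map g us) + polyline_length (map g vs)
        \<le> polyline_length (map g us @ [g b]) + polyline_length (g b # map g vs)"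
      by (rule add_mono)
    also have "\<dots> = polyline_length (map g (us @ b # vs))"
      by (simp add: polyline_length_append[of _ _ "map g vs"])
    also have "\<dots> \<le> arc_length g a c"
      using that assms by (intro polyline_length_le_arc_length) (fastforce simp: sorted_append)+
    finally show ?thesis .
  qed
  have ne: "{ts. sorted ts \<and> set ts \<subseteq> {x..y}} \<noteq> {}" for x y :: real
    by (auto intro: exI[of _ "[]"])
  have "arc_length g a b + polyline_length (map g vs) \<le> arc_length g a c"
    if "sorted vs" "set vs \<subseteq> {b..c}" for vs
    unfolding arc_length_def[of g a b]
    by (subst ennreal_SUP_add_left[symmetric, OF ne]) (use that key in \<open>auto intro!: SUP_least\<close>)
  then have "polyline_length (map g vs) + arc_length g a b \<le> arc_length g a c"
    if "sorted vs" "set vs \<subseteq> {b..c}" for vs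
    using that by (simp add: add.commute)
  then have "arc_length g b c + arc_length g a b \<le> arc_length g a c"
    unfolding arc_length_def[of g b c]
    by (subst ennreal_SUP_add_left[symmetric, OF ne]) (auto intro!: SUP_least)
  then show "arc_length g a b + arc_length g b c \<le> arc_length g a c"
    by (simp add: add.commute)
qed

lemma path_length_join:
  assumes "pathfinish g = pathstart h"
  shows "path_length (g +++ h) = path_length g + path_length h"
proof -
  have "path_length (g +++ h) = arc_length (g +++ h) 0 (1/2) + arc_length (g +++ h) (1/2) 1"
    unfolding path_length_eq_arc_length by (rule arc_length_add) auto
  also have "arc_length (g +++ h) 0 (1/2) = arc_length (\<lambda>x. g (2 * x + 0)) 0 (1/2)"
    by (rule arc_length_cong) (auto simp: joinpaths_def)
  also have "\<dots> = path_length g"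
    by (subst arc_length_affine) (auto simp: path_length_eq_arc_length)
  also have "arc_length (g +++ h) (1/2) 1 = arc_length (\<lambda>x. h (2 * x + (-1))) (1/2) 1"
  proof (rule arc_length_cong)
    fix x :: real assume "1/2 \<le> x" "x \<le> 1"
    then show "(g +++ h) x = h (2 * x + (-1))"
      using assms by (cases "2 * x = 1") (auto simp: joinpaths_def pathfinish_def pathstart_def)
  qed
  also have "\<dots> = path_length h"
    by (subst arc_length_affine) (auto simp: path_length_eq_arc_length)
  finally show ?thesis .
qed

lemma path_length_reversepath_le: "path_length (reversepath g) \<le> path_length g"
  unfolding path_length_eq_arc_length
proof (rule arc_length_leI)
  fix ts :: "real list" assume ts: "sorted ts" "set ts \<subseteq> {0..1}"
  have "sorted (rev (map (\<lambda>t. 1 - t) ts))"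
    using ts(1) by (induction ts) (auto simp: sorted_append)
  moreover have "set (rev (map (\<lambda>t. 1 - t) ts)) \<subseteq> {0..1}"
    using ts(2) by auto
  ultimately have "polyline_length (map g (rev (map (\<lambda>t. 1 - t) ts))) \<le> arc_length g 0 1"
    by (rule polyline_length_le_arc_length)
  moreover have "map g (rev (map (\<lambda>t. 1 - t) ts)) = rev (map (reversepath g) ts)"
    by (simp add: rev_map reversepath_def o_def)
  ultimately show "polyline_length (map (reversepath g) ts) \<le> arc_length g 0 1"
    by (simp add: polyline_length_rev)
qed

lemma path_length_reversepath: "path_length (reversepath g) = path_length g"
  using path_length_reversepath_le[of g] path_length_reversepath_le[of "reversepath g"]
  by (simp add: antisym)

lemma arc_length_Lipschitz:
  assumes L: "\<And>x y. a \<le> x \<Longrightarrow> x \<le> y \<Longrightarrow> y \<le> b \<Longrightarrow> dist (g x) (g y) \<le> L * (y - x)"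
    and "L \<ge> 0" "a \<le> b"
  shows "arc_length g a b \<le> ennreal (L * (b - a))"
proof (rule arc_length_leI)
  \<comment> \<open>Bounding by the remaining time \<open>b - t\<close> instead of
    \<open>b - a\<close> makes the induction over the partition telescope.\<close>
  have "polyline_length (map g (t # ts)) \<le> ennreal (L * (b - t))"
    if "sorted (t # ts)" "set (t # ts) \<subseteq> {a..b}" for t ts
    using that
  proof (induction ts arbitrary: t)
    case (Cons u ts)
    have "polyline_length (map g (t # u # ts)) \<le> ennreal (L * (u - t)) + ennreal (L * (b - u))"
      using Cons by (auto intro!: add_mono ennreal_leI L)
    also have "\<dots> = ennreal (L * (b - t))"
    proof -
      have "0 \<le> L * (u - t)" "0 \<le> L * (b - u)"
        using Cons.prems \<open>L \<ge> 0\<close> by auto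
      then show ?thesis
        by (simp flip: ennreal_plus) (simp add: algebra_simps)
    qed
    finally show ?case .
  qed simp
  note * = this
  fix ts assume ts: "sorted ts" "set ts \<subseteq> {a..b}"
  show "polyline_length (map g ts) \<le> ennreal (L * (b - a))"
  proof (cases ts)
    case (Cons u us)
    then have "polyline_length (map g ts) \<le> ennreal (L * (b - u))"
      using * ts by simp
    also have "\<dots> \<le> ennreal (L * (b - a))"
      using Cons ts \<open>L \<ge> 0\<close> by (intro ennreal_leI mult_left_mono) auto
    finally show ?thesis .
  qed simp
qed

lemma path_length_linepath: "path_length (linepath a b) = ennreal (dist a b)"
proof (rule antisym)
  have "dist (linepath a b x) (linepath a b y) = dist a b * (y - x)" if "x \<le> y" for x y
  proof -
    have "linepath a b x - linepath a b y = (y - x) *\<^sub>R (a - b)"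
      by (simp add: linepath_def algebra_simps)
    then show ?thesis
      using that by (simp add: dist_norm)
  qed
  then have "arc_length (linepath a b) 0 1 \<le> ennreal (dist a b * (1 - 0))"
    by (intro arc_length_Lipschitz) auto
  then show "path_length (linepath a b) \<le> ennreal (dist a b)"
    by (simp add: path_length_eq_arc_length)
  show "ennreal (dist a b) \<le> path_length (linepath a b)"
    using dist_le_arc_length[of 0 1 "linepath a b"]
    by (simp add: path_length_eq_arc_length linepath_0' linepath_1')
qed

text \<open>Truncating a partition of \<open>[a, b]\<close> at \<open>t\<close> and letting \<open>t\<close> tend to \<open>b\<close> shows that the
  arc length is continuous from the left.\<close>

lemma arc_length_le_left_limit:
  assumes "a < b" and g: "continuous_on {a..b} g"
    and B: "\<And>t. a \<le> t \<Longrightarrow> t < b \<Longrightarrow> arc_length g a t \<le> B"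
  shows "arc_length g a b \<le> B"
proof (rule arc_length_leI)
  fix ts assume ts: "sorted ts" "set ts \<subseteq> {a..b}"
  have lim: "((\<lambda>t. g (min s t)) \<longlongrightarrow> g s) (at_left b)" if "s \<in> {a..b}" for s
  proof -
    have "((\<lambda>t. min s t) \<longlongrightarrow> min s b) (at_left b)"
      by (intro tendsto_intros)
    moreover have "\<forall>\<^sub>F t in at_left b. min s t \<in> {a..b}"
      using eventually_at_left_real[OF \<open>a < b\<close>] by (rule eventually_mono) (use that in auto)
    ultimately show ?thesis
      using continuous_on_tendsto_compose[OF g, of "\<lambda>t. min s t" s "at_left b"] that
      by (auto simp: min_absorb1)
  qed
  have "((\<lambda>t. polyline_length (map g (map (\<lambda>s. min s t) ts))) \<longlongrightarrow> polyline_length (map g ts)) (at_left b)"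
    using ts(2)
  proof (induction ts rule: induct_list012)
    case (3 x y zs)
    then show ?case
      by (auto intro!: tendsto_add tendsto_ennrealI tendsto_dist lim)
  qed auto
  moreover have "\<forall>\<^sub>F t in at_left b. polyline_length (map g (map (\<lambda>s. min s t) ts)) \<le> B"
    using eventually_at_left_real[OF \<open>a < b\<close>]
  proof eventually_elim
    case (elim t)
    have "sorted (map (\<lambda>s. min s t) ts)"
      using ts(1) by (induction ts) (auto simp: min_def)
    moreover have "set (map (\<lambda>s. min s t) ts) \<subseteq> {a..t}"
      using ts(2) elim by auto
    ultimately have "polyline_length (map g (map (\<lambda>s. min s t) ts)) \<le> arc_length g a t"
      by (rule polyline_length_le_arc_length)
    then show ?case
      using B[of t] elim by (auto intro: order_trans)
  qed
  ultimately show "polyline_length (map g ts) \<le> B"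
    by (intro tendsto_upperbound) (auto simp: trivial_limit_at_left_real)
qed

text \<open>For nonzero \<open>c\<close> these are the orientation-preserving similarities. The one
  with parameters \<open>p\<close> and \<open>c\<close> leads from the map of an agent with start
  \<open>p\<close> and unit \<open>c\<close> back to the plane.\<close>

definition similarity :: "complex \<Rightarrow> complex \<Rightarrow> complex \<Rightarrow> complex" where
  "similarity b c z = b + c * z"

lemma polyline_length_similarity:
  "polyline_length (map (similarity b c) xs) = ennreal (cmod c) * polyline_length xs"
proof (induction xs rule: polyline_length.induct)
  case (1 x y zs)
  have "dist (similarity b c x) (similarity b c y) = cmod c * dist x y"
    by (simp add: similarity_def dist_norm norm_mult flip: right_diff_distrib)
  then show ?case
    using 1 by (simp add: ennreal_mult distrib_left)
qed auto

lemma path_length_similarity: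
  "path_length (similarity b c \<circ> g) = ennreal (cmod c) * path_length g"
proof -
  have *: "polyline_length (map (similarity b c \<circ> g) ts) = ennreal (cmod c) * polyline_length (map g ts)" for ts
    by (metis list.map_comp polyline_length_similarity)
  show ?thesis
    unfolding path_length_eq_arc_length arc_length_def SUP_mult_left_ennreal *  ..
qed

section \<open>Intrinsic distance and existence of shortest paths\<close>

text \<open>An infimum, unlike the chosen path in \<open>terrain_dist\<close>, is meaningful before
  shortest paths are known to exist; it is \<open>top\<close> if no path joins the points.\<close>

definition intrinsic_dist :: "complex set \<Rightarrow> complex \<Rightarrow> complex \<Rightarrow> ennreal" where
  "intrinsic_dist P x y = (INF h \<in> {h. path_within P x y h}. path_length h)"

lemma intrinsic_dist_le: "path_within P x y h \<Longrightarrow> intrinsic_dist P x y \<le> path_length h"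
  unfolding intrinsic_dist_def by (rule INF_lower) simp

lemma path_length_shortest_path:
  "shortest_path P x y g \<Longrightarrow> path_length g = intrinsic_dist P x y"
  unfolding shortest_path_def intrinsic_dist_def
  by (intro antisym INF_greatest INF_lower) auto

lemma shortest_pathI:
  "path_within P x y g \<Longrightarrow> path_length g \<le> intrinsic_dist P x y \<Longrightarrow> shortest_path P x y g"
  unfolding shortest_path_def using intrinsic_dist_le order_trans by blast

lemma path_within_join:
  "path_within P x y g \<Longrightarrow> path_within P y z h \<Longrightarrow> path_within P x z (g +++ h)"
  unfolding path_within_def by (auto simp: path_image_join)

lemma path_within_reversepath: "path_within P x y g \<Longrightarrow> path_within P y x (reversepath g)"
  unfolding path_within_def by auto

lemma path_within_subpath:
  assumes "path_within P x y g" "a \<in> {0..1}" "b \<in> {0..1}"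
  shows "path_within P (g a) (g b) (subpath a b g)"
  using assms path_image_subpath_subset[of a b g]
  unfolding path_within_def by (auto simp: path_subpath)

lemma path_within_linepath: "closed_segment x y \<subseteq> P \<Longrightarrow> path_within P x y (linepath x y)"
  unfolding path_within_def by auto

lemma path_within_in:
  assumes "path_within P x y g" "t \<in> {0..1}"
  shows "g t \<in> P"
  using assms unfolding path_within_def path_image_def by auto

lemma intrinsic_dist_segment:
  "closed_segment x y \<subseteq> P \<Longrightarrow> intrinsic_dist P x y \<le> ennreal (dist x y)"
  using intrinsic_dist_le[OF path_within_linepath] by (simp add: path_length_linepath)

lemma intrinsic_dist_commute: "intrinsic_dist P x y = intrinsic_dist P y x"
proof -
  have "intrinsic_dist P x y \<le> intrinsic_dist P y x" for x y
    unfolding intrinsic_dist_def[of P y x]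
    by (intro INF_greatest)
      (metis intrinsic_dist_le mem_Collect_eq path_length_reversepath path_within_reversepath)
  then show ?thesis by (simp add: antisym)
qed

text \<open>The infima need not be attained, so paths within \<open>e / 2\<close> of them are
  concatenated.\<close>

lemma intrinsic_dist_triangle:
  "intrinsic_dist P x z \<le> intrinsic_dist P x y + intrinsic_dist P y z"
proof (rule ennreal_le_epsilon)
  fix e :: real assume fin: "intrinsic_dist P x y + intrinsic_dist P y z < top" and "0 < e"
  have "\<exists>h. path_within P u v h \<and> path_length h \<le> intrinsic_dist P u v + ennreal (e / 2)"
    if "intrinsic_dist P u v < top" for u v
  proof -
    have "intrinsic_dist P u v < intrinsic_dist P u v + ennreal (e / 2)"
      using that \<open>0 < e\<close> by (simp add: less_top)
    then show ?thesis
      unfolding intrinsic_dist_def INF_less_iff by (auto intro: less_imp_le)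
  qed
  then obtain g h where g: "path_within P x y g" "path_length g \<le> intrinsic_dist P x y + ennreal (e / 2)"
    and h: "path_within P y z h" "path_length h \<le> intrinsic_dist P y z + ennreal (e / 2)"
    using fin by (metis ennreal_add_less_top)
  have "intrinsic_dist P x z \<le> path_length g + path_length h"
    using intrinsic_dist_le[OF path_within_join[OF g(1) h(1)]] g(1) h(1)
    by (subst (asm) path_length_join) (auto simp: path_within_def)
  also have "\<dots> \<le> (intrinsic_dist P x y + ennreal (e / 2)) + (intrinsic_dist P y z + ennreal (e / 2))"
    by (intro add_mono g h)
  also have "\<dots> = intrinsic_dist P x y + intrinsic_dist P y z + (ennreal (e / 2) + ennreal (e / 2))"
    by (simp add: algebra_simps)
  also have "ennreal (e / 2) + ennreal (e / 2) = ennreal e"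
    using \<open>0 < e\<close> by (simp flip: ennreal_plus)
  finally show "intrinsic_dist P x z \<le> intrinsic_dist P x y + intrinsic_dist P y z + ennreal e" .
qed

text \<open>A detour between \<open>g a\<close> and \<open>g b\<close> could be replaced by
  something shorter. Finiteness of the whole length is what allows the two outer arcs to be
  cancelled in \<open>ennreal\<close>.\<close>

lemma arc_length_shortest_path:
  assumes g: "shortest_path P x y g" and fin: "intrinsic_dist P x y < top"
    and ab: "0 \<le> a" "a \<le> b" "b \<le> 1"
  shows "arc_length g a b = intrinsic_dist P (g a) (g b)"
proof (rule antisym)
  have w: "path_within P x y g"
    using g by (simp add: shortest_path_def)
  have ends: "g 0 = x" "g 1 = y"
    using w by (auto simp: path_within_def pathstart_def pathfinish_def)
  have le: "intrinsic_dist P (g c) (g d) \<le> arc_length g c d" if "0 \<le> c" "c \<le> d" "d \<le> 1" for c d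
    using intrinsic_dist_le[OF path_within_subpath[OF w, of c d]] that
    by (simp add: path_length_subpath)
  show "intrinsic_dist P (g a) (g b) \<le> arc_length g a b"
    using le ab by simp
  have "path_length g = arc_length g 0 a + arc_length g b 1 + arc_length g a b"
    using arc_length_add[of 0 a 1 g] arc_length_add[of a b 1 g] ab
    by (simp add: path_length_eq_arc_length ac_simps)
  moreover have "path_length g \<le> arc_length g 0 a + arc_length g b 1 + intrinsic_dist P (g a) (g b)"
  proof -
    have "path_length g = intrinsic_dist P (g 0) (g 1)"
      using path_length_shortest_path[OF g] ends by simp
    also have "\<dots> \<le> intrinsic_dist P (g 0) (g a) + (intrinsic_dist P (g a) (g b) + intrinsic_dist P (g b) (g 1))"
      by (intro order_trans[OF intrinsic_dist_triangle[of P _ _ "g a"]] add_left_mono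
          intrinsic_dist_triangle)
    also have "\<dots> \<le> arc_length g 0 a + (intrinsic_dist P (g a) (g b) + arc_length g b 1)"
      using ab by (intro add_mono le order_refl) auto
    finally show ?thesis by (simp add: ac_simps)
  qed
  ultimately show "arc_length g a b \<le> intrinsic_dist P (g a) (g b)"
    using fin path_length_shortest_path[OF g]
    by (metis ennreal_add_left_cancel_le ennreal_add_less_top infinity_ennreal_def less_irrefl)
qed

text \<open>\<open>H r\<close> is the last point of \<open>h\<close> that is reached within arc length \<open>r * l\<close>.\<close>

lemma Lipschitz_reparametrization:
  assumes h: "path h" and len: "path_length h \<le> ennreal l" and "0 \<le> l"
  obtains H where "H 0 = h 0" "H 1 = h 1" "H ` {0..1} \<subseteq> path_image h"
    "\<And>x y. 0 \<le> x \<Longrightarrow> x \<le> y \<Longrightarrow> y \<le> 1 \<Longrightarrow> dist (H x) (H y) \<le> l * (y - x)"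
proof -
  define s where "s t = arc_length h 0 t" for t
  define A where "A r = {t \<in> {0..1}. s t \<le> ennreal (r * l)}" for r
  define \<tau> where "\<tau> r = Sup (A r)" for r
  have cont: "continuous_on {0..1} h"
    using h by (simp add: path_def)
  have s_mono: "s t \<le> s t'" if "t \<le> t'" for t t'
    unfolding s_def using that by (intro arc_length_mono) auto
  have A0: "0 \<in> A r" for r
    by (simp add: A_def s_def arc_length_refl)
  have bdd: "bdd_above (A r)" for r
    by (auto simp: A_def intro: bdd_aboveI[of _ 1])
  have \<tau>01: "0 \<le> \<tau> r" "\<tau> r \<le> 1" for r
    unfolding \<tau>_def using A0 bdd by (auto intro!: cSup_upper cSup_least simp: A_def)
  \<comment> \<open>The supremum belongs to \<open>A r\<close>: all earlier parameters satisfy the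
    bound, and arc length is continuous from the left.\<close>
  have s\<tau>: "s (\<tau> r) \<le> ennreal (r * l)" for r
  proof (cases "\<tau> r = 0")
    case True
    then show ?thesis by (simp add: s_def arc_length_refl)
  next
    case False
    show ?thesis
      unfolding s_def
    proof (rule arc_length_le_left_limit)
      show "0 < \<tau> r" using False \<tau>01[of r] by simp
      show "continuous_on {0..\<tau> r} h"
        using cont \<tau>01[of r] by (auto intro: continuous_on_subset)
      fix t assume "0 \<le> t" "t < \<tau> r"
      then obtain t' where "t' \<in> A r" "t < t'"
        using less_cSupE[of t "A r"] A0 unfolding \<tau>_def by blast
      then show "arc_length h 0 t \<le> ennreal (r * l)"
        using s_mono[of t t'] by (auto simp: A_def s_def)
    qed
  qed
  have above: "ennreal (r * l) < s t" if "\<tau> r < t" "t \<le> 1" for r t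
  proof (rule ccontr)
    assume "\<not> ennreal (r * l) < s t"
    then have "t \<in> A r"
      using that \<tau>01[of r] by (auto simp: A_def)
    then show False
      using cSup_upper[OF _ bdd] that by (fastforce simp: \<tau>_def)
  qed
  have lip: "dist (h (\<tau> x)) (h (\<tau> y)) \<le> l * (y - x)" if xy: "0 \<le> x" "x \<le> y" for x y
  proof (cases "\<tau> x < \<tau> y")
    case True
    \<comment> \<open>At \<open>\<tau> x\<close> itself only an upper bound on the arc length is
      known. Just to its right the arc length exceeds \<open>x * l\<close>, so at most
      \<open>(y - x) * l\<close> is left until \<open>\<tau> y\<close>; the estimate at
      \<open>\<tau> x\<close> follows in the limit from the right.\<close>
    have "((\<lambda>t. dist (h t) (h (\<tau> y))) \<longlongrightarrow> dist (h (\<tau> x)) (h (\<tau> y))) (at_right (\<tau> x))"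
    proof (intro tendsto_dist tendsto_const)
      have "continuous_on {\<tau> x..\<tau> y} h"
        using \<tau>01[of x] \<tau>01[of y] by (auto intro!: continuous_on_subset[OF cont])
      then show "(h \<longlongrightarrow> h (\<tau> x)) (at_right (\<tau> x))"
        using True continuous_on_Icc_at_rightD by blast
    qed
    moreover have "\<forall>\<^sub>F t in at_right (\<tau> x). dist (h t) (h (\<tau> y)) \<le> l * (y - x)"
      using eventually_at_right_real[OF True]
    proof (rule eventually_mono)
      fix t assume t: "t \<in> {\<tau> x<..<\<tau> y}"
      have "ennreal (x * l + dist (h t) (h (\<tau> y))) = ennreal (x * l) + ennreal (dist (h t) (h (\<tau> y)))"
        using xy \<open>0 \<le> l\<close> by (simp add: ennreal_plus)
      also have "\<dots> \<le> s t + arc_length h t (\<tau> y)"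
        using t above[of x t] \<tau>01[of y] by (intro add_mono dist_le_arc_length) auto
      also have "\<dots> = s (\<tau> y)"
        using t \<tau>01[of x] arc_length_add[of 0 t "\<tau> y" h] by (simp add: s_def)
      also have "\<dots> \<le> ennreal (y * l)"
        by (rule s\<tau>)
      finally have "x * l + dist (h t) (h (\<tau> y)) \<le> y * l"
        using xy \<open>0 \<le> l\<close> by (subst (asm) ennreal_le_iff) auto
      then show "dist (h t) (h (\<tau> y)) \<le> l * (y - x)"
        by (simp add: algebra_simps)
    qed
    ultimately show ?thesis
      by (intro tendsto_upperbound) auto
  next
    case False
    have "ennreal (x * l) \<le> ennreal (y * l)"
      using xy \<open>0 \<le> l\<close> by (intro ennreal_leI mult_right_mono) auto
    then have "A x \<subseteq> A y"
      by (auto simp: A_def)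
    then have "\<tau> x \<le> \<tau> y"
      unfolding \<tau>_def using A0 bdd by (intro cSup_subset_mono) auto
    then show ?thesis
      using False xy \<open>0 \<le> l\<close> by simp
  qed
  have "1 \<in> A 1"
    using len by (simp add: A_def s_def path_length_eq_arc_length)
  then have "\<tau> 1 = 1"
    using cSup_upper[OF _ bdd] \<tau>01[of 1] unfolding \<tau>_def by (meson antisym)
  \<comment> \<open>If \<open>h\<close> pauses at its start, \<open>\<tau> 0\<close> is positive,
    but the arc up to it has length 0.\<close>
  moreover have "h (\<tau> 0) = h 0"
    using dist_le_arc_length[of 0 "\<tau> 0" h] s\<tau>[of 0] \<tau>01[of 0] by (simp add: s_def ennreal_eq_0_iff)
  ultimately show ?thesis
    using \<tau>01 lip by (intro that[of "\<lambda>r. h (\<tau> r)"]) (auto simp: path_image_def)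
qed

text \<open>The direct method: paths of length at most \<open>l + 1 / (n + 1)\<close> are
  reparametrized with these numbers as Lipschitz constants, the Arzela-Ascoli theorem extracts a
  uniformly convergent subsequence, and its limit has Lipschitz constant \<open>l\<close>, hence
  length at most \<open>l\<close>.\<close>

lemma shortest_path_exists:
  assumes "closed P" "bounded P" and fin: "intrinsic_dist P p q < top"
  shows "\<exists>g. shortest_path P p q g"
proof -
  define l where "l = enn2real (intrinsic_dist P p q)"
  have l: "intrinsic_dist P p q = ennreal l" "0 \<le> l"
    using fin by (auto simp: l_def)
  have "\<exists>H. H 0 = p \<and> H 1 = q \<and> H ` {0..1} \<subseteq> P \<and>
      (\<forall>x y. 0 \<le> x \<longrightarrow> x \<le> y \<longrightarrow> y \<le> 1 \<longrightarrow> dist (H x) (H y) \<le> (l + 1 / real (Suc n)) * (y - x))" for n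
  proof -
    have "intrinsic_dist P p q < ennreal (l + 1 / real (Suc n))"
      unfolding l using l(2) by (intro ennreal_lessI) (auto intro: add_nonneg_pos)
    then obtain h where h: "path_within P p q h" "path_length h \<le> ennreal (l + 1 / real (Suc n))"
      unfolding intrinsic_dist_def INF_less_iff by (auto intro: less_imp_le)
    moreover have "0 \<le> l + 1 / real (Suc n)"
      using l(2) by simp
    ultimately obtain H where "H 0 = h 0" "H 1 = h 1" "H ` {0..1} \<subseteq> path_image h"
      "\<And>x y. 0 \<le> x \<Longrightarrow> x \<le> y \<Longrightarrow> y \<le> 1 \<Longrightarrow> dist (H x) (H y) \<le> (l + 1 / real (Suc n)) * (y - x)"
      using Lipschitz_reparametrization[of h "l + 1 / real (Suc n)"] by (auto simp: path_within_def)
    then show ?thesis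
      using h(1) unfolding path_within_def pathstart_def pathfinish_def by (intro exI[of _ H]) auto
  qed
  then obtain H where H0: "\<And>n. H n 0 = p" and H1: "\<And>n. H n 1 = q"
    and HP: "\<And>n x. x \<in> {0..1} \<Longrightarrow> H n x \<in> P"
    and H: "\<And>n x y. 0 \<le> x \<Longrightarrow> x \<le> y \<Longrightarrow> y \<le> 1 \<Longrightarrow>
      dist (H n x) (H n y) \<le> (l + 1 / real (Suc n)) * (y - x)"
    by (metis image_subset_iff)
  obtain M where M: "\<And>z. z \<in> P \<Longrightarrow> norm z \<le> M"
    using \<open>bounded P\<close> by (auto simp: bounded_iff)
  have lip: "dist (H n x) (H n y) \<le> (l + 1) * \<bar>y - x\<bar>" if "x \<in> {0..1}" "y \<in> {0..1}" for n x y
  proof -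
    have *: "(l + 1 / real (Suc n)) * d \<le> (l + 1) * d" if "0 \<le> d" for d
      using that by (intro mult_right_mono) auto
    show ?thesis
    proof (cases "x \<le> y")
      case True
      then show ?thesis using order_trans[OF H[of x y n] *[of "y - x"]] that by auto
    next
      case False
      then show ?thesis using order_trans[OF H[of y x n] *[of "x - y"]] that by (auto simp: dist_commute)
    qed
  qed
  obtain g k where g: "continuous_on {0..1::real} g" and k: "strict_mono (k :: nat \<Rightarrow> nat)"
    and unif: "\<And>e. 0 < e \<Longrightarrow> \<exists>N. \<forall>n x. n \<ge> N \<and> x \<in> {0..1} \<longrightarrow> norm (H (k n) x - g x) < e"
  proof (rule Arzela_Ascoli[of "{0..1::real}" H M])
    fix x e :: real assume x: "x \<in> {0..1}" and e: "0 < e"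
    show "\<exists>d. 0 < d \<and> (\<forall>n y. y \<in> {0..1} \<and> norm (x - y) < d \<longrightarrow> norm (H n x - H n y) < e)"
    \<comment> \<open>All members of the sequence share the Lipschitz constant \<open>l + 1\<close>,
      which also makes the divisor positive when \<open>l\<close> is 0.\<close>
    proof (intro exI[of _ "e / (l + 1)"] conjI allI impI)
      show "0 < e / (l + 1)" using e l by simp
      fix n y assume y: "y \<in> {0..1} \<and> norm (x - y) < e / (l + 1)"
      then have "(l + 1) * \<bar>y - x\<bar> < e"
        using l(2) by (simp add: field_simps abs_minus_commute)
      then show "norm (H n x - H n y) < e"
        using lip[of x y n] x y by (simp add: dist_norm)
    qed
  qed (use HP M in auto)
  have lim: "(\<lambda>n. H (k n) x) \<longlonglongrightarrow> g x" if "x \<in> {0..1}" for x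
    unfolding LIMSEQ_iff using unif that by blast
  have "(\<lambda>n. (l + 1 / real (Suc n)) * d) \<longlonglongrightarrow> (l + 0) * d" for d
    by (intro tendsto_intros LIMSEQ_Suc[OF lim_1_over_n])
  then have limk: "(\<lambda>n. (l + 1 / real (Suc (k n))) * d) \<longlonglongrightarrow> l * d" for d
    using LIMSEQ_subseq_LIMSEQ[OF _ k] by (fastforce simp: o_def)
  have "dist (g x) (g y) \<le> l * (y - x)" if "0 \<le> x" "x \<le> y" "y \<le> 1" for x y
    using that H by (intro LIMSEQ_le[OF tendsto_dist[OF lim lim] limk]) auto
  then have "path_length g \<le> ennreal l"
    using arc_length_Lipschitz[of 0 1 g l] l(2) by (simp add: path_length_eq_arc_length)
  moreover have "g 0 = p" "g 1 = q"
    using lim[of 0] lim[of 1] by (auto simp: H0 H1 LIMSEQ_const_iff)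
  moreover have "g x \<in> P" if "x \<in> {0..1}" for x
    using closed_sequentially[OF \<open>closed P\<close> _ lim[OF that]] HP that by blast
  ultimately have "shortest_path P p q g"
    using g l by (intro shortest_pathI)
      (auto simp: path_within_def path_def path_image_def pathstart_def pathfinish_def)
  then show ?thesis by blast
qed

section \<open>Local structure of terrains\<close>

lemma pathstart_polygonal_path [simp]: "pathstart (polygonal_path (v # vs)) = v"
  by (induction "v # vs" arbitrary: v vs rule: polygonal_path.induct) auto

lemma pathfinish_polygonal_path:
  "vs \<noteq> [] \<Longrightarrow> pathfinish (polygonal_path vs) = last vs"
  by (induction vs rule: polygonal_path.induct) auto

text \<open>The local analysis of the boundary needs only that it is a finite union of segments;
  their order along the curve is forgotten.\<close>

lemma path_image_polygonal_path:
  "\<exists>E. finite E \<and> path_image (polygonal_path vs) = (\<Union>(a, b)\<in>E. closed_segment a b)"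
proof (induction vs rule: polygonal_path.induct)
  case 1
  show ?case by (rule exI[of _ "{(0, 0)}"]) auto
next
  case (2 a)
  show ?case by (rule exI[of _ "{(a, a)}"]) auto
next
  case (3 a b)
  show ?case by (rule exI[of _ "{(a, b)}"]) auto
next
  case (4 a b c vs)
  then obtain E where "finite E"
    "path_image (polygonal_path (b # c # vs)) = (\<Union>(a, b)\<in>E. closed_segment a b)"
    by blast
  then show ?case
    by (intro exI[of _ "insert (a, b) E"]) (auto simp: path_image_join)
qed

text \<open>All of this comes from the Jordan curve theorem: \<open>P\<close> is both the closure of
  the inside of the curve and the complement of its outside. The last two facts express the absence
  of obstacles.\<close>

lemma terrain_boundary:
  assumes "terrain P"
  obtains C E where "finite E" "C = (\<Union>(a, b)\<in>E. closed_segment a b)"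
    "compact C" "P = C \<union> inside C" "frontier P = C" "interior P = inside C"
    "compact P" "connected P" "connected (- P)" "\<not> bounded (- P)"
proof -
  obtain vs where vs: "length vs \<ge> 3" "simple_path (polygonal_path (vs @ [hd vs]))"
    and P: "P = path_image (polygonal_path (vs @ [hd vs])) \<union>
      inside (path_image (polygonal_path (vs @ [hd vs])))"
    using assms unfolding terrain_def by blast
  define c where "c = polygonal_path (vs @ [hd vs])"
  define C where "C = path_image c"
  obtain v vs' where "vs = v # vs'"
    using vs(1) by (cases vs) auto
  then have "pathfinish c = pathstart c"
    unfolding c_def by (subst pathfinish_polygonal_path) auto
  then have J: "inside C \<noteq> {}" "open (inside C)" "connected (inside C)" "connected (outside C)"
    "\<not> bounded (outside C)" "frontier (inside C) = C" "frontier (outside C) = C"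
    using Jordan_inside_outside[of c] vs(2) unfolding C_def c_def by auto
  have PC: "P = C \<union> inside C"
    using P by (simp add: C_def c_def)
  then have Pout: "P = - outside C"
    by (simp add: union_with_inside)
  have "compact C"
    using vs(2) unfolding C_def c_def by (intro compact_path_image simple_path_imp_path)
  have fr: "frontier P = C"
    using J(7) by (simp add: Pout frontier_complement)
  have "interior P = P - frontier P"
    using interior_subset closure_subset by (auto simp: frontier_def)
  then have int: "interior P = inside C"
    using fr PC inside_no_overlap[of C] by blast
  have cl: "P = closure (inside C)"
    using J(6) by (simp add: closure_Un_frontier PC Un_commute)
  have "compact P"
    using bounded_inside[of C] compact_imp_bounded[OF \<open>compact C\<close>]
    by (simp add: cl compact_eq_bounded_closed bounded_closure)
  moreover have "connected P"
    unfolding cl by (rule connected_imp_connected_closure[OF J(3)])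
  moreover have "- P = outside C"
    by (simp add: Pout)
  ultimately show ?thesis
    using path_image_polygonal_path[of "vs @ [hd vs]"] that PC fr int J \<open>compact C\<close>
    unfolding C_def c_def by metis
qed

text \<open>The points are collinear: since \<open>z\<close> differs from \<open>x\<close>, the
  direction from \<open>x\<close> to \<open>y\<close> is that of the edge. Going this way one either
  stops on the edge or passes the end of the edge on that side.\<close>

lemma closed_segment_prolong:
  fixes a b x y z :: complex
  assumes x: "x \<in> closed_segment a b" and z: "z \<in> closed_segment a b"
    and zy: "z \<in> closed_segment x y" "z \<noteq> x"
  shows "y \<in> closed_segment a b \<or> a \<in> closed_segment x y - {x} \<or> b \<in> closed_segment x y - {x}"
proof -
  \<comment> \<open>The case where the direction points towards \<open>b\<close>; the other case
    follows by exchanging \<open>a\<close> and \<open>b\<close>, which turns a parameter \<alpha>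
    into \<open>1 - \<alpha>\<close>.\<close>
  have *: "y \<in> closed_segment a b \<or> b \<in> closed_segment x y - {x}"
    if \<alpha>: "x = a + \<alpha> *\<^sub>R (b - a)" "0 \<le> \<alpha>" and \<beta>: "z = a + \<beta> *\<^sub>R (b - a)" "\<beta> \<le> 1"
      and "\<alpha> < \<beta>" for \<alpha> \<beta> a b
  proof -
    obtain s where s: "0 \<le> s" "s \<le> 1" "z = x + s *\<^sub>R (y - x)"
      using zy(1) by (auto simp: closed_segment_def algebra_simps)
    have "s \<noteq> 0"
      using s zy(2) by auto
    \<comment> \<open>The parameter of \<open>y\<close> on the line through \<open>a\<close> and
      \<open>b\<close>: the step from \<open>x\<close> to \<open>z\<close> is the fraction
      \<open>s\<close> of the step from \<open>x\<close> to \<open>y\<close>.\<close>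
    define \<gamma> where "\<gamma> = \<alpha> + (\<beta> - \<alpha>) / s"
    have "(\<beta> - \<alpha>) * s \<le> (\<beta> - \<alpha>) * 1"
      using s \<open>\<alpha> < \<beta>\<close> by (intro mult_left_mono) auto
    then have "\<beta> \<le> \<gamma>"
      using s \<open>s \<noteq> 0\<close> by (simp add: \<gamma>_def field_simps)
    have "z - x = (\<beta> - \<alpha>) *\<^sub>R (b - a)"
      unfolding \<alpha>(1) \<beta>(1) by (simp add: algebra_simps)
    then have "s *\<^sub>R (y - x) = (\<beta> - \<alpha>) *\<^sub>R (b - a)"
      using s(3) by simp
    then have "(1 / s) *\<^sub>R s *\<^sub>R (y - x) = (1 / s) *\<^sub>R (\<beta> - \<alpha>) *\<^sub>R (b - a)"
      by simp
    then have yx: "y - x = (\<gamma> - \<alpha>) *\<^sub>R (b - a)"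
      using \<open>s \<noteq> 0\<close> by (simp add: \<gamma>_def)
    then have y: "y = a + \<gamma> *\<^sub>R (b - a)"
      using \<alpha>(1) by (simp add: algebra_simps)
    show ?thesis
    proof (cases "\<gamma> \<le> 1")
      case True
      have "y = (1 - \<gamma>) *\<^sub>R a + \<gamma> *\<^sub>R b"
        using y by (simp add: algebra_simps)
      then show ?thesis
        using True \<alpha>(2) \<open>\<alpha> < \<beta>\<close> \<open>\<beta> \<le> \<gamma>\<close> unfolding in_segment
        by (intro disjI1 exI[of _ \<gamma>]) auto
    next
      case False
      \<comment> \<open>The end \<open>b\<close> has parameter 1 and is overtaken at the fraction
        \<mu> of the way from \<open>x\<close> to \<open>y\<close>.\<close>
      define \<mu> where "\<mu> = (1 - \<alpha>) / (\<gamma> - \<alpha>)"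
      have "\<mu> * (\<gamma> - \<alpha>) = 1 - \<alpha>"
        using False \<open>\<alpha> < \<beta>\<close> \<beta>(2) by (simp add: \<mu>_def)
      then have "\<mu> *\<^sub>R (y - x) = (1 - \<alpha>) *\<^sub>R (b - a)"
        unfolding yx by simp
      moreover have "b - x = (1 - \<alpha>) *\<^sub>R (b - a)"
        unfolding \<alpha>(1) by (simp add: algebra_simps)
      ultimately have "b = x + \<mu> *\<^sub>R (y - x)"
        by (metis add.commute diff_add_cancel)
      then have "b = (1 - \<mu>) *\<^sub>R x + \<mu> *\<^sub>R y"
        by (simp add: algebra_simps)
      moreover have "0 \<le> \<mu>" "\<mu> \<le> 1"
        using False \<open>\<alpha> < \<beta>\<close> \<beta>(2) by (simp_all add: \<mu>_def)
      ultimately have "b \<in> closed_segment x y"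
        unfolding in_segment by (intro exI[of _ \<mu>] conjI)
      moreover have "b \<noteq> x"
      proof
        assume "b = x"
        then have "(1 - \<alpha>) *\<^sub>R (b - a) = 0"
          using \<alpha>(1) by (simp add: algebra_simps)
        then have "b = a"
          using \<open>\<alpha> < \<beta>\<close> \<beta>(2) by simp
        then show False
          using \<alpha>(1) \<beta>(1) zy(2) by simp
      qed
      ultimately show ?thesis
        by simp
    qed
  qed
  obtain \<alpha> where \<alpha>: "0 \<le> \<alpha>" "\<alpha> \<le> 1" "x = a + \<alpha> *\<^sub>R (b - a)"
    using x by (auto simp: closed_segment_def algebra_simps)
  obtain \<beta> where \<beta>: "0 \<le> \<beta>" "\<beta> \<le> 1" "z = a + \<beta> *\<^sub>R (b - a)"
    using z by (auto simp: closed_segment_def algebra_simps)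
  have "\<alpha> \<noteq> \<beta>"
    using \<alpha> \<beta> zy(2) by auto
  show ?thesis
  proof (cases "\<alpha> < \<beta>")
    case True
    then show ?thesis
      using *[OF \<alpha>(3,1) \<beta>(3,2)] by blast
  next
    case False
    have "x = b + (1 - \<alpha>) *\<^sub>R (a - b)" "z = b + (1 - \<beta>) *\<^sub>R (a - b)"
      unfolding \<alpha>(3) \<beta>(3) by (simp_all add: algebra_simps)
    then have "y \<in> closed_segment b a \<or> a \<in> closed_segment x y - {x}"
      using \<alpha>(2) \<beta>(1) False \<open>\<alpha> \<noteq> \<beta>\<close> by (intro *[of b "1 - \<alpha>" a "1 - \<beta>"]) simp_all
    then show ?thesis
      unfolding closed_segment_commute[of b a] by blast
  qed
qed

text \<open>A disc around \<open>x\<close> that meets only edges through \<open>x\<close> and contains no vertex other than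
  possibly \<open>x\<close> itself meets the boundary in a cone with apex \<open>x\<close>.\<close>

lemma terrain_locally_starlike:
  assumes "terrain P" "x \<in> P"
  obtains e where "e > 0"
    "\<And>y. y \<in> P \<Longrightarrow> dist x y < e \<Longrightarrow> closed_segment x y \<subseteq> P"
    "\<And>y. y \<in> P \<Longrightarrow> dist x y < e \<Longrightarrow> open_segment x y \<subseteq> interior P \<or> open_segment x y \<subseteq> frontier P"
proof -
  obtain C E where "finite E" and C: "C = (\<Union>(a, b)\<in>E. closed_segment a b)"
    and P: "P = C \<union> inside C" "frontier P = C" "interior P = inside C"
    using terrain_boundary[OF assms(1)] by metis
  define F where "F = (\<Union>(a, b)\<in>{(a, b) \<in> E. x \<notin> closed_segment a b}. closed_segment a b)
    \<union> ((fst ` E \<union> snd ` E) - {x})"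
  have "closed F"
    unfolding F_def using \<open>finite E\<close>
    by (intro closed_Un closed_UN) (auto simp: finite_imp_closed intro: finite_subset[of _ E])
  moreover have "x \<notin> F"
    by (auto simp: F_def)
  ultimately obtain e where "e > 0" and e: "ball x e \<subseteq> - F"
    by (metis ComplI open_Compl open_contains_ball)
  have edge: "x \<in> closed_segment a b" if "(a, b) \<in> E" "z \<in> closed_segment a b" "z \<in> ball x e" for a b z
  proof (rule ccontr)
    assume "x \<notin> closed_segment a b"
    then have "z \<in> F"
      using that unfolding F_def by blast
    then show False
      using that e by blast
  qed
  have vertex: "a \<notin> ball x e - {x}" "b \<notin> ball x e - {x}" if "(a, b) \<in> E" for a b
    using that e by (force simp: F_def)+
  have seg: "closed_segment x y \<subseteq> ball x e" if "dist x y < e" for y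
    using that \<open>e > 0\<close> by (intro closed_segment_subset) auto
  \<comment> \<open>The edge through \<open>z\<close> also contains \<open>x\<close>, and none of
    its ends lies in the disc except possibly \<open>x\<close>, so it must reach as far as
    \<open>y\<close>.\<close>
  have cone: "y \<in> C" if "dist x y < e" "z \<in> closed_segment x y" "z \<noteq> x" "z \<in> C" for y z
  proof -
    obtain a b where ab: "(a, b) \<in> E" "z \<in> closed_segment a b"
      using \<open>z \<in> C\<close> C by auto
    have "x \<in> closed_segment a b"
      using edge[OF ab] seg[OF that(1)] that(2) by blast
    then have "y \<in> closed_segment a b"
      using closed_segment_prolong[of x a b z y] ab that vertex[OF ab(1)] seg[OF that(1)] by blast
    then show ?thesis
      using ab C by auto
  qed
  have main: "open_segment x y \<subseteq> inside C \<or> open_segment x y \<subseteq> C"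
    if y: "y \<in> P" "dist x y < e" for y
  proof (cases "y \<in> C")
    case True
    then obtain a b where ab: "(a, b) \<in> E" "y \<in> closed_segment a b"
      using C by auto
    then have "x \<in> closed_segment a b"
      using edge y by auto
    then have "closed_segment x y \<subseteq> C"
      using ab C closed_segment_subset[OF _ ab(2) convex_closed_segment] by blast
    then show ?thesis
      using segment_open_subset_closed by blast
  next
    case False
    then have "y \<in> inside C"
      using y P(1) by auto
    have "z \<in> inside C" if z: "z \<in> open_segment x y" for z
    proof -
      have zc: "z \<in> closed_segment x y" "z \<noteq> x"
        using z by (auto simp: open_segment_def)
      \<comment> \<open>By \<open>cone\<close>, a boundary point between \<open>z\<close> and
        \<open>y\<close> would put \<open>y\<close> on the boundary. So \<open>z\<close> lies in the
        same component of the complement as \<open>y\<close>, that is, inside.\<close>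
      have "closed_segment z y \<subseteq> - C"
      proof
        fix w assume w: "w \<in> closed_segment z y"
        then have "w \<in> closed_segment x y"
          using zc(1) by (meson convex_closed_segment closed_segment_subset ends_in_segment(2) subsetD)
        moreover have "w \<noteq> x"
        proof
          \<comment> \<open>Then \<open>x\<close> would lie between \<open>z\<close> and
            \<open>y\<close>, and \<open>z\<close> between \<open>x\<close> and \<open>y\<close>,
            which forces them to be equal.\<close>
          assume "w = x"
          then have "dist z y = dist z x + dist x y" "dist x y = dist x z + dist z y"
            using w zc(1) by (auto simp flip: between_mem_segment simp: between)
          then show False
            using zc(2) by (auto simp: dist_commute)
        qed
        ultimately show "w \<in> - C"
          using cone[OF y(2)] False by blast
      qed
      then have "connected_component (- C) y z"
        unfolding connected_component_def
        by (intro exI[of _ "closed_segment z y"]) auto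
      then show ?thesis
        using \<open>y \<in> inside C\<close> inside_same_component by blast
    qed
    then show ?thesis by blast
  qed
  show ?thesis
  proof (rule that[OF \<open>e > 0\<close>])
    fix y assume y: "y \<in> P" "dist x y < e"
    show "open_segment x y \<subseteq> interior P \<or> open_segment x y \<subseteq> frontier P"
      using main[OF y] P by simp
    show "closed_segment x y \<subseteq> P"
      using main[OF y] P y(1) assms(2) by (auto simp: closed_segment_eq_open)
  qed
qed

text \<open>Being at finite distance is an equivalence relation. Local starlikeness makes its
  classes open in \<open>P\<close>, and \<open>P\<close> is connected.\<close>

lemma terrain_intrinsic_dist_finite:
  assumes P: "terrain P" and "p \<in> P" "q \<in> P"
  shows "intrinsic_dist P p q < top"
proof (rule connected_equivalence_relation[of P p q "\<lambda>x y. intrinsic_dist P x y < top"])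
  show "connected P"
    using terrain_boundary[OF P] by metis
  show "intrinsic_dist P y x < top" if "intrinsic_dist P x y < top" for x y
    using that by (subst intrinsic_dist_commute)
  show "intrinsic_dist P x z < top" if "intrinsic_dist P x y < top" "intrinsic_dist P y z < top" for x y z
    using that intrinsic_dist_triangle[of P x z y] by (auto intro: le_less_trans)
  fix x assume "x \<in> P"
  then obtain e where "e > 0" and e: "\<And>y. y \<in> P \<Longrightarrow> dist x y < e \<Longrightarrow> closed_segment x y \<subseteq> P"
    using terrain_locally_starlike[OF P] by metis
  have "intrinsic_dist P x y < top" if "y \<in> P \<inter> ball x e" for y
  proof -
    have "intrinsic_dist P x y \<le> ennreal (dist x y)"
      using that by (intro intrinsic_dist_segment e) auto
    then show ?thesis
      by (rule le_less_trans) simp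
  qed
  then show "\<exists>T. openin (top_of_set P) T \<and> x \<in> T \<and> (\<forall>y\<in>T. intrinsic_dist P x y < top)"
    using \<open>x \<in> P\<close> \<open>e > 0\<close> by (intro exI[of _ "P \<inter> ball x e"]) auto
qed (use assms in auto)

lemma terrain_shortest_path:
  assumes "terrain P" "p \<in> P" "q \<in> P"
  shows "\<exists>g. shortest_path P p q g"
proof (rule shortest_path_exists)
  have "compact P"
    using terrain_boundary[OF assms(1)] by metis
  then show "closed P" "bounded P"
    by (auto simp: compact_eq_bounded_closed)
qed (rule terrain_intrinsic_dist_finite[OF assms])

text \<open>All shortest paths have the same length, so the choice made in
  \<open>terrain_dist\<close> is harmless.\<close>

lemma terrain_dist_eq:
  assumes "terrain P" "p \<in> P" "q \<in> P"
  shows "terrain_dist P p q = intrinsic_dist P p q"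
  unfolding terrain_dist_def
  by (rule path_length_shortest_path) (rule someI_ex[OF terrain_shortest_path[OF assms]])

section \<open>Shortest paths in terrains\<close>

lemma shortest_pathD:
  assumes "shortest_path P p q g"
  shows "path_within P p q g" "g 0 = p" "g 1 = q" "continuous_on {0..1} g"
    "\<And>t. t \<in> {0..1} \<Longrightarrow> g t \<in> P"
  using assms path_within_in[of P p q g]
  by (auto simp: shortest_path_def path_within_def pathstart_def pathfinish_def path_def)

locale terrain_shortest =
  fixes P p q g
  assumes P: "terrain P" and p: "p \<in> P" and q: "q \<in> P" and g: "shortest_path P p q g"
begin

lemmas g_path = shortest_pathD[OF g]

lemma arc_length_eq:
  "0 \<le> a \<Longrightarrow> a \<le> b \<Longrightarrow> b \<le> 1 \<Longrightarrow> arc_length g a b = intrinsic_dist P (g a) (g b)"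
  by (rule arc_length_shortest_path[OF g terrain_intrinsic_dist_finite[OF P p q]])

lemma arc_length_finite: "0 \<le> a \<Longrightarrow> a \<le> b \<Longrightarrow> b \<le> 1 \<Longrightarrow> arc_length g a b < top"
  using terrain_intrinsic_dist_finite[OF P] g_path(5) by (simp add: arc_length_eq)

lemma arc_length_visible:
  assumes "0 \<le> a" "a \<le> b" "b \<le> 1" "closed_segment (g a) (g b) \<subseteq> P"
  shows "arc_length g a b = ennreal (dist (g a) (g b))"
  using assms arc_length_eq[of a b] intrinsic_dist_segment[of "g a" "g b" P] dist_le_arc_length[of a b g]
  by (simp add: antisym)

text \<open>The arc is no longer than the segment, so each of its points attains equality in the
  triangle inequality. Conversely, the distance from \<open>g a\<close> takes all intermediate
  values along the arc, and on the segment this distance determines the point.\<close>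

lemma image_visible:
  assumes ab: "0 \<le> a" "a \<le> b" "b \<le> 1" and vis: "closed_segment (g a) (g b) \<subseteq> P"
  shows "g ` {a..b} = closed_segment (g a) (g b)"
proof
  show sub: "g ` {a..b} \<subseteq> closed_segment (g a) (g b)"
  proof
    fix z assume "z \<in> g ` {a..b}"
    then obtain t where t: "a \<le> t" "t \<le> b" "z = g t" by auto
    have "ennreal (dist (g a) z + dist z (g b)) = ennreal (dist (g a) z) + ennreal (dist z (g b))"
      by (simp add: ennreal_plus)
    also have "\<dots> \<le> arc_length g a t + arc_length g t b"
      using t by (intro add_mono) (auto intro: dist_le_arc_length)
    also have "\<dots> = ennreal (dist (g a) (g b))"
      using arc_length_visible[OF ab vis] arc_length_add[of a t b g] t by simp
    finally have "dist (g a) z + dist z (g b) \<le> dist (g a) (g b)"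
      by (subst (asm) ennreal_le_iff) auto
    then have "dist (g a) (g b) = dist (g a) z + dist z (g b)"
      using dist_triangle[of "g a" "g b" z] by linarith
    then show "z \<in> closed_segment (g a) (g b)"
      by (simp flip: between_mem_segment add: between)
  qed
  show "closed_segment (g a) (g b) \<subseteq> g ` {a..b}"
  proof
    fix z assume "z \<in> closed_segment (g a) (g b)"
    then obtain s where s: "0 \<le> s" "s \<le> 1" "z = (1 - s) *\<^sub>R g a + s *\<^sub>R g b"
      by (auto simp: in_segment)
    have "continuous_on {a..b} (\<lambda>t. dist (g a) (g t))"
      using g_path(4) ab by (intro continuous_intros) (auto intro: continuous_on_subset)
    moreover have "dist (g a) (g a) \<le> s * dist (g a) (g b)" "s * dist (g a) (g b) \<le> dist (g a) (g b)"
      using s by (auto simp: mult_left_le_one_le)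
    ultimately obtain t where t: "a \<le> t" "t \<le> b" "dist (g a) (g t) = s * dist (g a) (g b)"
      using IVT'[of "\<lambda>t. dist (g a) (g t)" a "s * dist (g a) (g b)" b] ab by blast
    then obtain r where r: "0 \<le> r" "r \<le> 1" "g t = (1 - r) *\<^sub>R g a + r *\<^sub>R g b"
      using sub by (force simp: in_segment)
    have "g t - g a = r *\<^sub>R (g b - g a)"
      using r by (simp add: algebra_simps)
    then have "dist (g a) (g t) = norm (r *\<^sub>R (g b - g a))"
      by (metis dist_commute dist_norm)
    then have "dist (g a) (g t) = r * dist (g a) (g b)"
      using r(1) by (simp add: dist_norm norm_minus_commute)
    then have "g t = z"
    proof (cases "g a = g b")
      case True
      then show ?thesis
        using r(3) s(3) by (simp flip: scaleR_add_left)
    next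
      case False
      then have "r = s"
        using t(3) \<open>dist (g a) (g t) = r * dist (g a) (g b)\<close> by simp
      then show ?thesis
        using r(3) s(3) by simp
    qed
    then show "z \<in> g ` {a..b}"
      using t by auto
  qed
qed

lemma arc_length_0_imp_eq:
  "a \<le> t \<Longrightarrow> t \<le> b \<Longrightarrow> arc_length g a b = 0 \<Longrightarrow> g t = g a"
  using dist_le_arc_length[of a t g] arc_length_mono[of a a t b g]
  by (simp add: ennreal_eq_0_iff)

text \<open>The degenerate segment from \<open>g a\<close> to itself lies in \<open>P\<close>, so
  the arc has length 0. A shortest path may pause but never returns to a point it has left; this
  replaces injectivity.\<close>

lemma loop_const:
  assumes "0 \<le> a" "a \<le> t" "t \<le> b" "b \<le> 1" "g a = g b"
  shows "g t = g a"
proof -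
  have "g a \<in> P"
    using assms g_path(5) by simp
  then have "arc_length g a b = 0"
    using arc_length_visible[of a b] assms by simp
  then show ?thesis
    using arc_length_0_imp_eq assms by simp
qed

text \<open>A real-valued copy of the arc length, for continuity and the intermediate value
  theorem.\<close>

definition "travelled t = enn2real (arc_length g 0 t)"

lemma ennreal_travelled: "0 \<le> t \<Longrightarrow> t \<le> 1 \<Longrightarrow> ennreal (travelled t) = arc_length g 0 t"
  using arc_length_finite[of 0 t] by (simp add: travelled_def)

lemma travelled_diff:
  assumes "0 \<le> a" "a \<le> b" "b \<le> 1" "closed_segment (g a) (g b) \<subseteq> P"
  shows "travelled b = travelled a + dist (g a) (g b)"
proof -
  have "travelled b = enn2real (arc_length g 0 a + ennreal (dist (g a) (g b)))"
    using arc_length_add[of 0 a b g] assms arc_length_visible[of a b] by (simp add: travelled_def)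
  then show ?thesis
    using arc_length_finite[of 0 a] assms by (simp add: enn2real_plus travelled_def)
qed

lemma local_visible:
  assumes "x \<in> {0..1}"
  obtains d where "d > 0"
    "\<And>y. y \<in> {0..1} \<Longrightarrow> \<bar>y - x\<bar> < d \<Longrightarrow> closed_segment (g x) (g y) \<subseteq> P"
    "\<And>y. y \<in> {0..1} \<Longrightarrow> \<bar>y - x\<bar> < d \<Longrightarrow>
      open_segment (g x) (g y) \<subseteq> interior P \<or> open_segment (g x) (g y) \<subseteq> frontier P"
proof -
  obtain e where e: "e > 0"
    "\<And>y. y \<in> P \<Longrightarrow> dist (g x) y < e \<Longrightarrow> closed_segment (g x) y \<subseteq> P"
    "\<And>y. y \<in> P \<Longrightarrow> dist (g x) y < e \<Longrightarrow>
      open_segment (g x) y \<subseteq> interior P \<or> open_segment (g x) y \<subseteq> frontier P"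
    using terrain_locally_starlike[OF P g_path(5)[OF assms]] by metis
  obtain d where "d > 0" "\<And>y. y \<in> {0..1} \<Longrightarrow> dist y x < d \<Longrightarrow> dist (g y) (g x) < e"
    using g_path(4) assms \<open>e > 0\<close> unfolding continuous_on_iff by meson
  then show ?thesis
    using e(2,3) g_path(5) by (intro that[of d]) (auto simp: dist_commute dist_real_def)
qed

text \<open>Near \<open>x\<close> the path sees \<open>g x\<close>, so increments of
  \<open>travelled\<close> from \<open>x\<close> are plain distances, and continuity is inherited
  from \<open>g\<close>.\<close>

lemma continuous_on_travelled: "continuous_on {0..1} travelled"
proof -
  have "\<exists>d>0. \<forall>y\<in>{0..1}. dist y x < d \<longrightarrow> dist (travelled y) (travelled x) < e"
    if x: "x \<in> {0..1}" and "e > 0" for x e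
  proof -
    obtain d where d: "d > 0"
      "\<And>y. y \<in> {0..1} \<Longrightarrow> \<bar>y - x\<bar> < d \<Longrightarrow> closed_segment (g x) (g y) \<subseteq> P"
      using local_visible[OF x] by metis
    obtain d' where d': "d' > 0" "\<And>y. y \<in> {0..1} \<Longrightarrow> dist y x < d' \<Longrightarrow> dist (g y) (g x) < e"
      using g_path(4) x \<open>e > 0\<close> unfolding continuous_on_iff by meson
    show ?thesis
    proof (intro exI[of _ "min d d'"] conjI ballI impI)
      fix y :: real assume y: "y \<in> {0..1}" "dist y x < min d d'"
      have seg: "closed_segment (g x) (g y) \<subseteq> P"
        using d(2)[of y] y by (simp add: dist_real_def)
      have "dist (travelled y) (travelled x) = dist (g y) (g x)"
      proof (cases "x \<le> y")
        case True
        then show ?thesis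
          using travelled_diff[of x y] x y seg by (simp add: dist_real_def dist_commute)
      next
        case False
        then show ?thesis
          using travelled_diff[of y x] x y seg
          by (simp add: dist_real_def closed_segment_commute)
      qed
      then show "dist (travelled y) (travelled x) < e"
        using d'(2) y by simp
    qed (use d d' in auto)
  qed
  then show ?thesis
    unfolding continuous_on_iff by blast
qed

lemma midpoint_exists:
  "\<exists>u\<in>{0..1}. path_length (subpath 0 u g) = path_length g / 2"
proof -
  have "travelled 0 = 0"
    by (simp add: travelled_def arc_length_refl)
  moreover have "0 \<le> travelled 1"
    by (simp add: travelled_def)
  ultimately obtain u where u: "0 \<le> u" "u \<le> 1" "travelled u = travelled 1 / 2"
    using IVT'[OF _ _ _ continuous_on_travelled, of "travelled 1 / 2"] by auto
  have "path_length (subpath 0 u g) = ennreal (travelled 1 / 2)"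
    using u by (simp add: path_length_subpath flip: ennreal_travelled u(3))
  also have "\<dots> = path_length g / 2"
    using \<open>0 \<le> travelled 1\<close>
    by (simp add: path_length_eq_arc_length ennreal_divide_numeral flip: ennreal_travelled)
  finally show ?thesis
    using u by auto
qed

end

section \<open>Executing a shortest path by instructions\<close>

definition follows :: "complex list \<Rightarrow> (real \<Rightarrow> complex) \<Rightarrow> real \<Rightarrow> real \<Rightarrow> bool" where
  "follows vs g a b \<longleftrightarrow>
     (\<exists>\<tau>. \<tau> 0 = a \<and> \<tau> (length vs - 1) = b \<and>
        (\<forall>i < length vs. g (\<tau> i) = vs ! i) \<and>
        (\<forall>i < length vs - 1.
           \<tau> i \<le> \<tau> (Suc i) \<and> g ` {\<tau> i..\<tau> (Suc i)} = closed_segment (vs ! i) (vs ! Suc i)))"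

lemma runs_along_eq_follows: "runs_along vs g u = follows vs g 0 u"
  by (simp add: runs_along_def follows_def)

text \<open>Routes are assembled from the end backwards by prepending steps. Hence
  \<open>follows\<close> has a free starting parameter, unlike \<open>runs_along\<close>, which
  starts at 0.\<close>

lemma follows_Cons:
  assumes "follows (g b # vs) g b c" "a \<le> b" "g ` {a..b} = closed_segment (g a) (g b)"
  shows "follows (g a # g b # vs) g a c"
proof -
  obtain \<tau> where \<tau>: "\<tau> 0 = b" "\<tau> (length (g b # vs) - 1) = c"
    "\<forall>i < length (g b # vs). g (\<tau> i) = (g b # vs) ! i"
    "\<forall>i < length (g b # vs) - 1. \<tau> i \<le> \<tau> (Suc i) \<and>
      g ` {\<tau> i..\<tau> (Suc i)} = closed_segment ((g b # vs) ! i) ((g b # vs) ! Suc i)"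
    using assms(1) unfolding follows_def by blast
  show ?thesis
    unfolding follows_def
  proof (intro exI[of _ "case_nat a \<tau>"] conjI allI impI)
    fix i assume i: "i < length (g a # g b # vs)"
    show "g (case_nat a \<tau> i) = (g a # g b # vs) ! i"
      using i \<tau>(3) by (cases i) simp_all
  next
    fix i assume i: "i < length (g a # g b # vs) - 1"
    show "case_nat a \<tau> i \<le> case_nat a \<tau> (Suc i)"
      using i \<tau>(1,4) assms(2) by (cases i) simp_all
    show "g ` {case_nat a \<tau> i..case_nat a \<tau> (Suc i)} =
        closed_segment ((g a # g b # vs) ! i) ((g a # g b # vs) ! Suc i)"
      using i \<tau>(1,4) assms(3) by (cases i) simp_all
  qed (use \<tau>(2) in simp_all)
qed

lemma advance_eq:
  assumes "open_segment a (a + v) \<subseteq> A"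
  shows "advance A a v = a + v"
proof -
  have "Sup {r \<in> {0..1}. open_segment a (a + r *\<^sub>R v) \<subseteq> A} = 1"
    by (rule cSup_eq_maximum) (use assms in auto)
  then show ?thesis
    by (simp add: advance_def)
qed

lemma step_exists:
  assumes "open_segment a b \<subseteq> interior P \<or> open_segment a b \<subseteq> frontier P" "c \<noteq> 0"
  shows "\<exists>s. step P c a s = b"
  using assms(1)
proof
  assume "open_segment a b \<subseteq> interior P"
  \<comment> \<open>Dividing by \<open>c\<close> cancels the factor with which \<open>step\<close>
    converts from the coordinates of the agent.\<close>
  then show ?thesis
    using advance_eq[of a "b - a" "interior P"] \<open>c \<noteq> 0\<close> by (intro exI[of _ "Go ((b - a) / c)"]) simp
next
  assume "open_segment a b \<subseteq> frontier P"
  then show ?thesis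
    using advance_eq[of a "b - a" "frontier P"] \<open>c \<noteq> 0\<close> by (intro exI[of _ "Follow ((b - a) / c)"]) simp
qed

lemma route_eq_Cons: "\<exists>vs. route P c a ss = a # vs"
  by (cases ss) auto

context terrain_shortest
begin

lemma route_step:
  assumes ab: "0 \<le> a" "a \<le> b" "b \<le> 1" and "c \<noteq> 0"
    and vis: "closed_segment (g a) (g b) \<subseteq> P"
    and op: "open_segment (g a) (g b) \<subseteq> interior P \<or> open_segment (g a) (g b) \<subseteq> frontier P"
    and ss: "follows (route P c (g b) ss) g b d"
  shows "\<exists>ss. follows (route P c (g a) ss) g a d"
proof -
  obtain s where s: "step P c (g a) s = g b"
    using step_exists[OF op \<open>c \<noteq> 0\<close>] by blast
  obtain vs where "route P c (g b) ss = g b # vs"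
    using route_eq_Cons by blast
  then show ?thesis
    using follows_Cons[of g b vs d a] image_visible[OF ab vis] ss s ab
    by (intro exI[of _ "s # ss"]) simp
qed

text \<open>The property of an interval used for compactness is that every execution starting at its
  right end can be extended backwards to its left end. In this form it passes at once to adjacent
  intervals.\<close>

lemma route_exists:
  assumes "0 \<le> u" "u \<le> 1" "c \<noteq> 0"
  shows "\<exists>ss. follows (route P c (g 0) ss) g 0 u"
proof -
  have "0 \<le> (0::real) \<longrightarrow> u \<le> 1 \<longrightarrow> (\<forall>ss d. follows (route P c (g u) ss) g u d \<longrightarrow>
    (\<exists>ss. follows (route P c (g 0) ss) g 0 d))"
  proof (rule Bolzano[OF \<open>0 \<le> u\<close>, of "\<lambda>a b. 0 \<le> a \<longrightarrow> b \<le> 1 \<longrightarrow>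
      (\<forall>ss d. follows (route P c (g b) ss) g b d \<longrightarrow> (\<exists>ss. follows (route P c (g a) ss) g a d))"])
    fix x assume "0 \<le> x" "x \<le> u"
    then have "x \<in> {0..1}"
      using assms by simp
    then obtain e where e: "e > 0"
      "\<And>y. y \<in> {0..1} \<Longrightarrow> \<bar>y - x\<bar> < e \<Longrightarrow> closed_segment (g x) (g y) \<subseteq> P"
      "\<And>y. y \<in> {0..1} \<Longrightarrow> \<bar>y - x\<bar> < e \<Longrightarrow>
        open_segment (g x) (g y) \<subseteq> interior P \<or> open_segment (g x) (g y) \<subseteq> frontier P"
      using local_visible by metis
    \<comment> \<open>Visibility is known only from \<open>g x\<close>, so an interval around
      \<open>x\<close> costs two straight moves, with a stop at \<open>g x\<close>.\<close>
    have "\<exists>ss. follows (route P c (g a) ss) g a d"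
      if ab: "a \<le> x" "x \<le> b" "b - a < e" "0 \<le> a" "b \<le> 1" and ss: "follows (route P c (g b) ss) g b d"
      for a b ss d
    proof -
      obtain ss' where "follows (route P c (g x) ss') g x d"
        using route_step[of x b, OF _ _ _ \<open>c \<noteq> 0\<close> e(2,3) ss] ab by auto
      moreover have "closed_segment (g a) (g x) \<subseteq> P"
        "open_segment (g a) (g x) \<subseteq> interior P \<or> open_segment (g a) (g x) \<subseteq> frontier P"
        using e(2,3)[of a] ab
        by (simp_all add: closed_segment_commute[of "g a"] open_segment_commute[of "g a"])
      ultimately show ?thesis
        using ab by (intro route_step[of a x]) (simp_all add: \<open>c \<noteq> 0\<close>)
    qed
    then show "\<exists>e>0. \<forall>a b. a \<le> x \<and> x \<le> b \<and> b - a < e \<longrightarrow> 0 \<le> a \<longrightarrow> b \<le> 1 \<longrightarrow>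
      (\<forall>ss d. follows (route P c (g b) ss) g b d \<longrightarrow> (\<exists>ss. follows (route P c (g a) ss) g a d))"
      using \<open>e > 0\<close> by blast
  next
    fix a b e :: real
    assume *: "0 \<le> a \<longrightarrow> b \<le> 1 \<longrightarrow>
        (\<forall>ss d. follows (route P c (g b) ss) g b d \<longrightarrow> (\<exists>ss. follows (route P c (g a) ss) g a d))"
      "0 \<le> b \<longrightarrow> e \<le> 1 \<longrightarrow>
        (\<forall>ss d. follows (route P c (g e) ss) g e d \<longrightarrow> (\<exists>ss. follows (route P c (g b) ss) g b d))"
      and "a \<le> b" "b \<le> e"
    show "0 \<le> a \<longrightarrow> e \<le> 1 \<longrightarrow>
        (\<forall>ss d. follows (route P c (g e) ss) g e d \<longrightarrow> (\<exists>ss. follows (route P c (g a) ss) g a d))"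
    proof (intro impI allI)
      fix ss d assume ae: "0 \<le> a" "e \<le> 1" and ss: "follows (route P c (g e) ss) g e d"
      have "0 \<le> b" "b \<le> 1"
        using ae \<open>a \<le> b\<close> \<open>b \<le> e\<close> by auto
      then show "\<exists>ss. follows (route P c (g a) ss) g a d"
        using * ae ss by metis
    qed
  qed
  moreover have "follows (route P c (g u) []) g u u"
    unfolding follows_def by (intro exI[of _ "\<lambda>_. u"]) auto
  ultimately show ?thesis
    using assms(2) by (metis order_refl)
qed

end

section \<open>Uniqueness\<close>

lemma closed_segment_between:
  fixes w e :: complex
  assumes "norm e = 1" "0 \<le> r" "0 \<le> s"
  shows "w \<in> closed_segment (w + r *\<^sub>R e) (w - s *\<^sub>R e)"
proof -
  have "w + r *\<^sub>R e - (w - s *\<^sub>R e) = (r + s) *\<^sub>R e"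
    by (simp add: algebra_simps)
  then have "dist (w + r *\<^sub>R e) (w - s *\<^sub>R e) = r + s"
    using assms unfolding dist_norm by simp
  then show ?thesis
    using assms by (simp add: between dist_norm flip: between_mem_segment)
qed

text \<open>Look from \<open>w\<close> in all directions.  If no chord through \<open>w\<close> joined two points of the same
  set, the directions in which \<open>G\<^sub>1\<close> and \<open>G\<^sub>2\<close> are visible would form disjoint closed sets
  that cover the unit circle and are interchanged by the antipodal map.\<close>

lemma chord_through_inside:
  fixes w :: complex
  assumes G: "compact G1" "compact G2" and P: "closed P"
    and sub: "G1 \<union> G2 \<union> inside (G1 \<union> G2) \<subseteq> P" and w: "w \<in> inside (G1 \<union> G2)"
  shows "\<exists>G\<in>{G1, G2}. \<exists>y\<in>G. \<exists>y'\<in>G. w \<in> closed_segment y y' \<and> closed_segment y y' \<subseteq> P"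
proof (rule ccontr)
  assume no_chord: "\<not> ?thesis"
  define A where "A G = {e \<in> sphere 0 1. \<exists>r\<ge>0. w + r *\<^sub>R e \<in> G \<and> closed_segment w (w + r *\<^sub>R e) \<subseteq> P}"
    for G
  have closed_A: "closed (A G)" if K: "compact G" for G
  proof -
    obtain M where M: "\<And>z. z \<in> G \<Longrightarrow> dist w z \<le> M"
      using compact_imp_bounded[OF K] bounded_any_center[of G w] by auto
    \<comment> \<open>Pairs of a direction and a distance at which \<open>G\<close> is seen.
      Visibility is written as an intersection of closed conditions, one for each point of the
      segment, so \<open>B\<close> is compact; \<open>A G\<close> is its projection to the
      directions.\<close>
    define B where "B = (sphere 0 1 \<times> {0..M}) \<inter> ((\<lambda>(e, r). w + r *\<^sub>R e) -` G \<inter>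
      (\<Inter>s\<in>{0..1}. (\<lambda>(e, r). w + (s * r) *\<^sub>R e) -` P))"
    have "closed ((\<lambda>(e, r). w + r *\<^sub>R e) -` G)"
      using compact_imp_closed[OF K]
      by (intro closed_vimage) (auto simp: case_prod_unfold intro!: continuous_intros)
    moreover have "closed ((\<lambda>(e, r). w + (s * r) *\<^sub>R e) -` P)" for s
      using P by (intro closed_vimage) (auto simp: case_prod_unfold intro!: continuous_intros)
    ultimately have "compact B"
      unfolding B_def by (intro compact_Int_closed compact_Times closed_Int closed_INT) auto
    moreover have "A G = fst ` B"
    proof
      show "A G \<subseteq> fst ` B"
      proof
        fix e assume "e \<in> A G"
        then obtain r where r: "norm e = 1" "0 \<le> r" "w + r *\<^sub>R e \<in> G"
          "closed_segment w (w + r *\<^sub>R e) \<subseteq> P"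
          by (auto simp: A_def)
        have "r \<le> M"
          using M[OF r(3)] r by (simp add: dist_norm)
        moreover have "w + (s * r) *\<^sub>R e \<in> P" if "s \<in> {0..1}" for s
        proof -
          have "w + (s * r) *\<^sub>R e = (1 - s) *\<^sub>R w + s *\<^sub>R (w + r *\<^sub>R e)"
            by (simp add: algebra_simps)
          then have "w + (s * r) *\<^sub>R e \<in> closed_segment w (w + r *\<^sub>R e)"
            using that unfolding in_segment by (intro exI[of _ s]) auto
          then show ?thesis using r(4) by blast
        qed
        ultimately have "(e, r) \<in> B"
          using r by (auto simp: B_def)
        then show "e \<in> fst ` B" by force
      qed
      show "fst ` B \<subseteq> A G"
      proof
        fix e assume "e \<in> fst ` B"
        then obtain r where r: "norm e = 1" "0 \<le> r" "w + r *\<^sub>R e \<in> G"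
          "\<And>s. s \<in> {0..1} \<Longrightarrow> w + (s * r) *\<^sub>R e \<in> P"
          by (auto simp: B_def)
        have "closed_segment w (w + r *\<^sub>R e) \<subseteq> P"
        proof
          fix z assume "z \<in> closed_segment w (w + r *\<^sub>R e)"
          then obtain s where s: "0 \<le> s" "s \<le> 1" "z = (1 - s) *\<^sub>R w + s *\<^sub>R (w + r *\<^sub>R e)"
            by (auto simp: in_segment)
          then have "z = w + (s * r) *\<^sub>R e"
            by (simp add: algebra_simps)
          then show "z \<in> P" using r(4)[of s] s by simp
        qed
        then show "e \<in> A G"
          using r by (auto simp: A_def)
      qed
    qed
    ultimately show ?thesis
      using compact_imp_closed[OF compact_continuous_image[OF continuous_on_fst[OF continuous_on_id]]]
      by simp
  qed
  \<comment> \<open>Two opposite lines of sight to the same set would join to a forbidden chord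
    through \<open>w\<close>.\<close>
  have opposite: "- e \<notin> A G" if e: "G \<in> {G1, G2}" "e \<in> A G" for G e
  proof
    assume "- e \<in> A G"
    then obtain s where s: "0 \<le> s" "w - s *\<^sub>R e \<in> G" "closed_segment w (w - s *\<^sub>R e) \<subseteq> P"
      by (auto simp: A_def)
    obtain r where r: "norm e = 1" "0 \<le> r" "w + r *\<^sub>R e \<in> G" "closed_segment w (w + r *\<^sub>R e) \<subseteq> P"
      using e(2) by (auto simp: A_def)
    have mem: "w \<in> closed_segment (w + r *\<^sub>R e) (w - s *\<^sub>R e)"
      using r s by (intro closed_segment_between)
    then have "closed_segment (w + r *\<^sub>R e) (w - s *\<^sub>R e) =
        closed_segment (w + r *\<^sub>R e) w \<union> closed_segment w (w - s *\<^sub>R e)"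
      by (simp add: Un_closed_segment)
    then have "closed_segment (w + r *\<^sub>R e) (w - s *\<^sub>R e) \<subseteq> P"
      using r(4) s(3) by (simp add: closed_segment_commute[of "w + r *\<^sub>R e"])
    then show False
      using no_chord e(1) r(3) s(2) mem by blast
  qed
  have cover: "e \<in> A G1 \<union> A G2" if e: "e \<in> sphere 0 1" for e
  proof -
    let ?G = "G1 \<union> G2"
    have "compact ?G"
      using G by (rule compact_Un)
    then have "open (inside ?G)" "bounded (inside ?G)"
      using open_inside[OF compact_imp_closed] bounded_inside[OF compact_imp_bounded] by blast+
    moreover have "e \<noteq> 0"
      using e by auto
    \<comment> \<open>The ray leaves the bounded open set \<open>inside ?G\<close> for the first
      time at distance \<open>d\<close>. The exit point belongs to \<open>?G\<close>, and everything
      before it is inside, hence in \<open>P\<close>.\<close>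
    ultimately obtain d where d: "0 < d" "w + d *\<^sub>R e \<in> frontier (inside ?G)"
      "\<And>s. 0 \<le> s \<Longrightarrow> s < d \<Longrightarrow> w + s *\<^sub>R e \<in> interior (inside ?G)"
      using ray_to_frontier[of "inside ?G" w e] w interior_open[of "inside ?G"] by metis
    have "w + d *\<^sub>R e \<in> ?G"
      using d(2) frontier_inside_subset[of ?G] compact_imp_closed[OF \<open>compact ?G\<close>] by blast
    moreover have "closed_segment w (w + d *\<^sub>R e) \<subseteq> P"
    proof
      fix z assume "z \<in> closed_segment w (w + d *\<^sub>R e)"
      then obtain s where s: "0 \<le> s" "s \<le> 1" "z = (1 - s) *\<^sub>R w + s *\<^sub>R (w + d *\<^sub>R e)"
        by (auto simp: in_segment)
      then have z: "z = w + (s * d) *\<^sub>R e"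
        by (simp add: algebra_simps)
      show "z \<in> P"
      proof (cases "s = 1")
        case True
        then show ?thesis using z \<open>w + d *\<^sub>R e \<in> ?G\<close> sub by auto
      next
        case False
        then have "s * d < d" using s d(1) by simp
        then have "z \<in> inside ?G"
          using d(1) d(3)[of "s * d"] s interior_subset z by (metis mult_nonneg_nonneg less_imp_le subsetD)
        then show ?thesis using sub by blast
      qed
    qed
    ultimately have "e \<in> A G" if "w + d *\<^sub>R e \<in> G" for G
      using e less_imp_le[OF d(1)] that unfolding A_def by blast
    then show ?thesis
      using \<open>w + d *\<^sub>R e \<in> ?G\<close> by blast
  qed
  have minus: "- e \<in> sphere 0 1" if "e \<in> sphere 0 1" for e :: complex
    using that by simp
  have one: "(1::complex) \<in> sphere 0 1"
    by simp
  have "connected (sphere (0::complex) 1)"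
    by (rule connected_sphere) simp
  \<comment> \<open>If both sets are seen in direction \<open>e\<close>, whichever is seen in
    direction \<open>- e\<close> violates \<open>opposite\<close>.\<close>
  moreover have "A G1 \<inter> A G2 \<inter> sphere 0 1 = {}"
  proof (rule ccontr)
    assume "A G1 \<inter> A G2 \<inter> sphere 0 1 \<noteq> {}"
    then obtain e where "e \<in> A G1" "e \<in> A G2" "e \<in> sphere 0 1"
      by blast
    then show False
      using opposite[of G1 e] opposite[of G2 e] cover[OF minus[of e]] by blast
  qed
  moreover have "sphere 0 1 \<subseteq> A G1 \<union> A G2"
    using cover by (rule subsetI)
  ultimately have "A G1 \<inter> sphere 0 1 = {} \<or> A G2 \<inter> sphere 0 1 = {}"
    using closed_A[OF G(1)] closed_A[OF G(2)] by (rule connected_closedD)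
  \<comment> \<open>One of the two closed sets misses the circle, so the other contains all
    directions, in particular the opposite directions 1 and -1.\<close>
  then obtain G where G: "G \<in> {G1, G2}" "sphere 0 1 \<subseteq> A G"
    using cover by blast
  then show False
    using opposite[of G 1] minus[OF one] one by blast
qed

context terrain_shortest
begin

text \<open>The arc between two points of a shortest path that see each other is the segment between
  them; the order of their parameters does not matter.\<close>

lemma segment_subset_image:
  assumes "y \<in> path_image g" "y' \<in> path_image g" "closed_segment y y' \<subseteq> P"
  shows "closed_segment y y' \<subseteq> path_image g"
proof -
  have *: "closed_segment (g a) (g b) \<subseteq> path_image g"
    if "0 \<le> a" "a \<le> b" "b \<le> 1" "closed_segment (g a) (g b) \<subseteq> P" for a b
    using image_visible[OF that] that(1,3) by (force simp: path_image_def)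
  obtain a b where ab: "a \<in> {0..1}" "b \<in> {0..1}" "y = g a" "y' = g b"
    using assms(1,2) by (auto simp: path_image_def)
  then show ?thesis
    using *[of a b] *[of b a] assms(3)
    by (cases "a \<le> b") (simp_all add: closed_segment_commute[of "g b"])
qed

text \<open>Omitting a point \<open>g t\<close> would separate \<open>p\<close> from
  \<open>q\<close> in \<open>S\<close>: the closed arcs before and after \<open>t\<close> meet, by
  \<open>loop_const\<close>, in \<open>g t\<close> alone.\<close>

lemma connected_subset_image:
  assumes S: "connected S" "S \<subseteq> path_image g" "p \<in> S" "q \<in> S"
  shows "path_image g \<subseteq> S"
proof (rule ccontr)
  assume "\<not> path_image g \<subseteq> S"
  then obtain t where t: "t \<in> {0..1}" "g t \<notin> S"
    unfolding path_image_def by blast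
  have cont: "continuous_on {0..t} g" "continuous_on {t..1} g"
    using g_path(4) t by (auto intro: continuous_on_subset)
  have "closed (g ` {0..t})" "closed (g ` {t..1})"
    using cont by (auto intro!: compact_imp_closed compact_continuous_image)
  moreover have "S \<subseteq> g ` {0..t} \<union> g ` {t..1}"
  proof
    fix z assume "z \<in> S"
    then obtain a where "a \<in> {0..1}" "z = g a"
      using S(2) by (auto simp: path_image_def)
    then show "z \<in> g ` {0..t} \<union> g ` {t..1}"
      by (cases "a \<le> t") auto
  qed
  moreover have "g ` {0..t} \<inter> g ` {t..1} \<inter> S = {}"
  proof -
    have False if "a \<in> {0..t}" "b \<in> {t..1}" "g a = g b" "g a \<in> S" for a b
      using loop_const[of a t b] that t by auto
    then show ?thesis by force
  qed
  moreover have "p \<in> g ` {0..t}" "q \<in> g ` {t..1}"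
    using g_path(2,3) t by (auto intro!: image_eqI[of p g 0] image_eqI[of q g 1])
  ultimately show False
    using connected_closedD[OF S(1), of "g ` {0..t}" "g ` {t..1}"] S(3,4) by blast
qed

lemma compact_image: "compact (path_image g)"
  using g_path(1) by (auto simp: path_within_def compact_path_image)

lemma connected_image: "connected (path_image g)"
  using g_path(1) by (auto simp: path_within_def connected_path_image)

lemma ends_in_image: "p \<in> path_image g" "q \<in> path_image g"
  using g_path(1) by (auto simp: path_within_def)

lemma image_subset: "path_image g \<subseteq> P"
  using g_path(1) by (simp add: path_within_def)

end

text \<open>The absence of holes enters here: from a point off \<open>P\<close> the whole unbounded
  set \<open>- P\<close> is reachable without crossing \<open>G\<close>.\<close>

lemma inside_subset:
  assumes "G \<subseteq> P" "connected (- P)" "\<not> bounded (- P)"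
  shows "inside G \<subseteq> P"
proof
  fix w assume w: "w \<in> inside G"
  show "w \<in> P"
  proof (rule ccontr)
    assume "w \<notin> P"
    then have "- P \<subseteq> connected_component_set (- G) w"
      using assms by (intro connected_component_maximal) auto
    then show False
      using w assms(3) bounded_subset by (auto simp: inside_def)
  qed
qed

lemma shortest_path_image_unique:
  assumes P: "terrain P" and pq: "p \<in> P" "q \<in> P"
    and g1: "shortest_path P p q g1" and g2: "shortest_path P p q g2"
  shows "path_image g1 = path_image g2"
proof -
  interpret g1: terrain_shortest P p q g1 using assms by unfold_locales
  interpret g2: terrain_shortest P p q g2 using assms by unfold_locales
  let ?G = "path_image g1 \<union> path_image g2"
  obtain P': "compact P" "connected (- P)" "\<not> bounded (- P)"
    using terrain_boundary[OF P] by metis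
  have inside: "inside ?G \<subseteq> P"
    using g1.image_subset g2.image_subset P' by (intro inside_subset) auto
  have "inside ?G = {}"
  proof (rule ccontr)
    assume "inside ?G \<noteq> {}"
    then obtain w where w: "w \<in> inside ?G" by blast
    have "\<exists>G\<in>{path_image g1, path_image g2}. \<exists>y\<in>G. \<exists>y'\<in>G.
        w \<in> closed_segment y y' \<and> closed_segment y y' \<subseteq> P"
      using inside g1.image_subset g2.image_subset w compact_imp_closed[OF P'(1)]
      by (intro chord_through_inside g1.compact_image g2.compact_image) simp_all
    then have "w \<in> ?G"
      using g1.segment_subset_image g2.segment_subset_image by blast
    then show False
      using w inside_no_overlap[of ?G] by blast
  qed
  then have "- ?G = outside ?G"
    using inside_Un_outside[of ?G] by simp
  then have "connected (- ?G)"
    using connected_outside[of ?G] compact_imp_bounded[OF g1.compact_image]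
      compact_imp_bounded[OF g2.compact_image] by simp
  \<comment> \<open>The dual form of Janiszewski's theorem: two compact connected plane sets whose
    union does not separate the plane have a connected intersection.\<close>
  then have "connected (path_image g1 \<inter> path_image g2)"
    by (intro Janiszewski_dual g1.compact_image g2.compact_image g1.connected_image g2.connected_image)
  then show ?thesis
    using g1.connected_subset_image[of "path_image g1 \<inter> path_image g2"]
      g2.connected_subset_image[of "path_image g1 \<inter> path_image g2"]
      g1.ends_in_image g2.ends_in_image by blast
qed

lemma ennreal_half_plus_half: "x / 2 + x / 2 = (x::ennreal)"
proof (cases x)
  case (real r)
  then show ?thesis
    by (simp add: ennreal_divide_numeral flip: ennreal_plus)
qed (simp add: ennreal_top_divide)

text \<open>Parameters on \<open>g1\<close> and \<open>g2\<close> are unrelated, so the midpoint of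
  \<open>g2\<close> is carried to a point \<open>g1 t\<close> of the common image and recognized
  there by its distance to \<open>q\<close>.\<close>

lemma midpoint_unique:
  assumes P: "terrain P" and pq: "p \<in> P" "q \<in> P"
    and g1: "shortest_path P p q g1" and g2: "shortest_path P q p g2"
    and u1: "u1 \<in> {0..1}" "path_length (subpath 0 u1 g1) = path_length g1 / 2"
    and u2: "u2 \<in> {0..1}" "path_length (subpath 0 u2 g2) = path_length g2 / 2"
  shows "g1 u1 = g2 u2"
proof -
  interpret g1: terrain_shortest P p q g1 using assms by unfold_locales
  interpret g2: terrain_shortest P q p g2 using assms by unfold_locales
  have len: "path_length g1 = intrinsic_dist P p q" "path_length g2 = intrinsic_dist P p q"
    using path_length_shortest_path[OF g1] path_length_shortest_path[OF g2]
    by (simp_all add: intrinsic_dist_commute[of P q p])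
  have fin: "intrinsic_dist P p q < top"
    by (rule terrain_intrinsic_dist_finite[OF P pq])
  have "shortest_path P p q (reversepath g2)"
    using path_within_reversepath[OF g2.g_path(1)] len
    by (intro shortest_pathI) (simp_all add: path_length_reversepath)
  then have "path_image g1 = path_image g2"
    using shortest_path_image_unique[OF P pq g1] by fastforce
  then obtain t where t: "t \<in> {0..1}" "g2 u2 = g1 t"
    using u2(1) unfolding path_image_def by blast
  have half: "arc_length g1 0 u1 = intrinsic_dist P p q / 2"
    using u1 len by (simp add: path_length_subpath)
  have "intrinsic_dist P q (g2 u2) = intrinsic_dist P p q / 2"
    using u2 len g2.arc_length_eq[of 0 u2] g2.g_path(2) by (simp add: path_length_subpath)
  then have "arc_length g1 t 1 = intrinsic_dist P p q / 2"
    using t g1.arc_length_eq[of t 1] g1.g_path(3) by (simp add: intrinsic_dist_commute[of P q])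
  moreover have "arc_length g1 0 t + arc_length g1 t 1 = intrinsic_dist P p q"
    using arc_length_add[of 0 t 1 g1] t len by (simp add: path_length_eq_arc_length)
  moreover have "intrinsic_dist P p q / 2 + intrinsic_dist P p q / 2 = intrinsic_dist P p q"
    by (rule ennreal_half_plus_half)
  ultimately have half': "arc_length g1 0 t = intrinsic_dist P p q / 2"
    using fin by (metis add.commute ennreal_add_left_cancel ennreal_add_less_top infinity_ennreal_def less_irrefl)
  \<comment> \<open>The parameters \<open>u1\<close> and \<open>t\<close> may differ if
    \<open>g1\<close> pauses at the midpoint, but the arc between them has length 0.\<close>
  have "g1 (max u1 t) = g1 (min u1 t)"
  proof (rule g1.arc_length_0_imp_eq)
    have "arc_length g1 0 (min u1 t) + arc_length g1 (min u1 t) (max u1 t) = arc_length g1 0 (max u1 t)"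
      using u1 t by (subst arc_length_add[symmetric]) auto
    then have "intrinsic_dist P p q / 2 + arc_length g1 (min u1 t) (max u1 t) = intrinsic_dist P p q / 2 + 0"
      using half half' by (simp add: min_def max_def split: if_splits)
    then show "arc_length g1 (min u1 t) (max u1 t) = 0"
      using fin half' g1.arc_length_finite[of 0 t] t
      unfolding ennreal_add_left_cancel by auto
  qed auto
  then show ?thesis
    using t by (auto simp: min_def max_def split: if_splits)
qed

section \<open>Changing the coordinates\<close>

lemma similarity_inverse [simp]:
  assumes "c \<noteq> 0"
  shows "similarity (- (b / c)) (1 / c) (similarity b c z) = z"
    "similarity b c (similarity (- (b / c)) (1 / c) z) = z"
  using assms by (simp_all add: similarity_def field_simps)

lemma similarity_comp_inverse [simp]:
  assumes "c \<noteq> 0"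
  shows "similarity (- (b / c)) (1 / c) \<circ> (similarity b c \<circ> g) = g"
    "similarity b c \<circ> (similarity (- (b / c)) (1 / c) \<circ> g) = g"
  using assms by (simp_all add: fun_eq_iff)

lemma similarity_image_inverse [simp]:
  assumes "c \<noteq> 0"
  shows "similarity (- (b / c)) (1 / c) ` similarity b c ` A = A"
    "similarity b c ` similarity (- (b / c)) (1 / c) ` A = A"
  using assms by (simp_all add: image_image)

lemma inj_similarity: "c \<noteq> 0 \<Longrightarrow> inj (similarity b c)"
  by (auto simp: inj_def similarity_def)

lemma similarity_eq_image: "similarity b c ` A = (+) b ` (*) c ` A"
  by (simp add: image_image similarity_def)

lemma linear_mult_complex: "linear ((*) (c::complex))"
  by (simp add: linear_times)

lemma inj_mult_complex: "c \<noteq> 0 \<Longrightarrow> inj ((*) (c::complex))"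
  by (simp add: inj_def)

lemma interior_similarity:
  assumes "c \<noteq> 0"
  shows "interior (similarity b c ` A) = similarity b c ` interior A"
  using interior_injective_linear_image[OF linear_mult_complex inj_mult_complex[OF assms], of A]
  unfolding similarity_eq_image interior_translation by simp

lemma frontier_similarity:
  assumes "c \<noteq> 0"
  shows "frontier (similarity b c ` A) = similarity b c ` frontier A"
proof -
  have "closure (similarity b c ` A) = similarity b c ` closure A"
    using closure_injective_linear_image[OF linear_mult_complex inj_mult_complex[OF assms], of A]
    unfolding similarity_eq_image closure_translation by simp
  then show ?thesis
    using image_set_diff[OF inj_similarity[OF assms]]
    by (simp add: frontier_def interior_similarity[OF assms])
qed

lemma closed_segment_similarity:
  "closed_segment (similarity b c x) (similarity b c y) = similarity b c ` closed_segment x y"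
proof -
  have "closed_segment (c * x) (c * y) = (*) c ` closed_segment x y"
    by (rule closed_segment_linear_image[OF linear_mult_complex])
  then show ?thesis
    using closed_segment_translation[of b "c * x" "c * y"]
    by (simp add: similarity_eq_image) (simp add: similarity_def)
qed

lemma open_segment_similarity:
  "c \<noteq> 0 \<Longrightarrow>
    open_segment (similarity b c x) (similarity b c y) = similarity b c ` open_segment x y"
  using image_set_diff[OF inj_similarity, of c b "closed_segment x y" "{x, y}"]
  by (simp add: open_segment_def closed_segment_similarity)

lemma path_within_similarity:
  assumes "path_within P x y g"
  shows "path_within (similarity b c ` P) (similarity b c x) (similarity b c y) (similarity b c \<circ> g)"
proof -
  have "continuous_on A (similarity b c)" for A
    unfolding similarity_def by (intro continuous_intros)
  then show ?thesis
    using assms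
    by (auto simp: path_within_def path_image_compose pathstart_compose pathfinish_compose
        intro!: path_continuous_image)
qed

text \<open>A competing path in the image is pulled back by the inverse similarity; all lengths are
  scaled by the same factor.\<close>

lemma shortest_path_similarity:
  assumes g: "shortest_path P x y g" and "c \<noteq> 0"
  shows "shortest_path (similarity b c ` P) (similarity b c x) (similarity b c y) (similarity b c \<circ> g)"
  unfolding shortest_path_def
proof (intro conjI allI impI)
  show "path_within (similarity b c ` P) (similarity b c x) (similarity b c y) (similarity b c \<circ> g)"
    using g by (intro path_within_similarity) (simp add: shortest_path_def)
  fix h assume "path_within (similarity b c ` P) (similarity b c x) (similarity b c y) h"
  from path_within_similarity[OF this, of "- (b / c)" "1 / c"]
  have "path_within P x y (similarity (- (b / c)) (1 / c) \<circ> h)"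
    using \<open>c \<noteq> 0\<close> by simp
  then have "path_length g \<le> path_length (similarity (- (b / c)) (1 / c) \<circ> h)"
    using g by (simp add: shortest_path_def)
  then have "path_length (similarity b c \<circ> g)
      \<le> path_length (similarity b c \<circ> (similarity (- (b / c)) (1 / c) \<circ> h))"
    unfolding path_length_similarity[of b c] by (intro mult_left_mono) auto
  then show "path_length (similarity b c \<circ> g) \<le> path_length h"
    using \<open>c \<noteq> 0\<close> by simp
qed

text \<open>The displacement is scaled together with the set, so the supremum in
  \<open>advance\<close> is taken over the same set of numbers.\<close>

lemma advance_similarity:
  assumes "c \<noteq> 0"
  shows "advance (similarity b c ` A) (similarity b c a) (c * v) = similarity b c (advance A a v)"
proof -
  have eq: "similarity b c a + r *\<^sub>R (c * v) = similarity b c (a + r *\<^sub>R v)" for r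
    by (simp add: similarity_def algebra_simps)
  show ?thesis
    unfolding advance_def eq open_segment_similarity[OF assms]
    by (simp add: inj_image_subset_iff[OF inj_similarity[OF assms]])
qed

lemma step_similarity:
  "c \<noteq> 0 \<Longrightarrow> step (similarity b c ` P) (c * d) (similarity b c a) s = similarity b c (step P d a s)"
  by (cases s) (simp_all add: interior_similarity frontier_similarity mult.assoc advance_similarity)

text \<open>With \<open>1 / c\<close> as the factor and \<open>c\<close> as the unit of the agent,
  the unit on the map becomes 1, the value used in \<open>RVM\<close>. The same instructions thus
  serve on the map and in the plane.\<close>

lemma route_similarity:
  "c \<noteq> 0 \<Longrightarrow>
    route (similarity b c ` P) (c * d) (similarity b c a) ss = map (similarity b c) (route P d a ss)"
  by (induction ss arbitrary: a) (simp_all add: step_similarity)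

lemma runs_along_similarity:
  assumes "runs_along vs g u"
  shows "runs_along (map (similarity b c) vs) (similarity b c \<circ> g) u"
proof -
  obtain \<tau> where \<tau>: "\<tau> 0 = 0" "\<tau> (length vs - 1) = u" "\<forall>i < length vs. g (\<tau> i) = vs ! i"
    "\<forall>i < length vs - 1. \<tau> i \<le> \<tau> (Suc i) \<and>
       g ` {\<tau> i..\<tau> (Suc i)} = closed_segment (vs ! i) (vs ! Suc i)"
    using assms unfolding runs_along_def by blast
  have "(similarity b c \<circ> g) ` A = similarity b c ` g ` A" for A
    by (rule image_comp[symmetric])
  then show ?thesis
    unfolding runs_along_def using \<tau>
    by (intro exI[of _ \<tau>]) (simp add: closed_segment_similarity del: comp_apply, simp)
qed

text \<open>The condition by which \<open>RVM\<close> selects instructions, isolated so that it can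
  be carried between map and plane.\<close>

definition runs_to_midpoint :: "complex list \<Rightarrow> (real \<Rightarrow> complex) \<Rightarrow> bool" where
  "runs_to_midpoint vs g \<longleftrightarrow>
     (\<exists>u\<in>{0..1}. path_length (subpath 0 u g) = path_length g / 2 \<and> runs_along vs g u)"

lemma runs_to_midpoint_similarity:
  assumes "runs_to_midpoint vs g"
  shows "runs_to_midpoint (map (similarity b c) vs) (similarity b c \<circ> g)"
proof -
  have "subpath 0 u (similarity b c \<circ> g) = similarity b c \<circ> subpath 0 u g" for u
    by (simp add: subpath_def o_def)
  then show ?thesis
    using assms runs_along_similarity[of vs g _ b c] unfolding runs_to_midpoint_def
    by (metis path_length_similarity ennreal_times_divide)
qed

lemma (in terrain_shortest) midpoint_route_exists:
  assumes "c \<noteq> 0"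
  shows "\<exists>ss. runs_to_midpoint (route P c p ss) g"
proof -
  obtain u where u: "u \<in> {0..1}" "path_length (subpath 0 u g) = path_length g / 2"
    using midpoint_exists by blast
  moreover have "\<exists>ss. follows (route P c p ss) g 0 u"
    using route_exists[of u c] assms g_path(2) u(1) by simp
  ultimately show ?thesis
    unfolding runs_to_midpoint_def runs_along_eq_follows by blast
qed

text \<open>Existence of a shortest path and of instructions is proved in the plane, where
  \<open>P\<close> is a terrain, and carried to the map to justify both choices in
  \<open>RVM\<close>. The outcome is then carried back, so the chart itself never has to be
  recognized as a terrain.\<close>

lemma agent_route_RVM:
  assumes P: "terrain P" and pq: "p \<in> P" "q \<in> P" and c: "c \<noteq> 0"
  shows "\<exists>g. shortest_path P p q g \<and> runs_to_midpoint (agent_route RVM P c p q) g"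
proof -
  let ?\<phi> = "similarity (- (p / c)) (1 / c)" and ?\<psi> = "similarity p c"
  have "(\<lambda>z. (z - p) / c) = ?\<phi>"
    using c by (simp add: fun_eq_iff similarity_def diff_divide_distrib)
  then have m: "map_view P c p q = \<lparr>chart = ?\<phi> ` P, own = ?\<phi> p, other = ?\<phi> q\<rparr>"
    by (simp add: map_view_def Let_def)
  define g where "g = (SOME g. shortest_path (?\<phi> ` P) (?\<phi> p) (?\<phi> q) g)"
  obtain h where "shortest_path P p q h"
    using terrain_shortest_path[OF P pq] by blast
  then have "shortest_path (?\<phi> ` P) (?\<phi> p) (?\<phi> q) (?\<phi> \<circ> h)"
    using c by (intro shortest_path_similarity) auto
  then have g: "shortest_path (?\<phi> ` P) (?\<phi> p) (?\<phi> q) g"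
    unfolding g_def by (rule someI[where P = "shortest_path (?\<phi> ` P) (?\<phi> p) (?\<phi> q)"])
  from shortest_path_similarity[OF g c, of p]
  have g': "shortest_path P p q (?\<psi> \<circ> g)"
    using c by simp
  have route: "route (?\<phi> ` P) 1 (?\<phi> p) ss = map ?\<phi> (route P c p ss)" for ss
    using route_similarity[of "1 / c" "- (p / c)" P c p ss] c by simp
  have "\<exists>ss. runs_to_midpoint (route (?\<phi> ` P) 1 (?\<phi> p) ss) g"
  proof -
    interpret terrain_shortest P p q "?\<psi> \<circ> g"
      using P pq g' by unfold_locales
    obtain ss where "runs_to_midpoint (route P c p ss) (?\<psi> \<circ> g)"
      using midpoint_route_exists[OF c] by blast
    from runs_to_midpoint_similarity[OF this, of "- (p / c)" "1 / c"]
    show ?thesis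
      using c route by auto
  qed
  moreover have "RVM (map_view P c p q) =
      (SOME ss. runs_to_midpoint (route (?\<phi> ` P) 1 (?\<phi> p) ss) g)"
    unfolding RVM_def m g_def runs_to_midpoint_def Let_def by simp
  ultimately have "runs_to_midpoint (route (?\<phi> ` P) 1 (?\<phi> p) (RVM (map_view P c p q))) g"
    by (metis someI_ex)
  from runs_to_midpoint_similarity[OF this, of p c]
  have "runs_to_midpoint (agent_route RVM P c p q) (?\<psi> \<circ> g)"
    unfolding route agent_route_def using c by (simp add: o_def)
  then show ?thesis
    using g' by blast
qed

section \<open>Walks\<close>

lemma runs_along_polyline:
  assumes "runs_along vs g u" "vs \<noteq> []"
  shows "vs ! 0 = g 0" "last vs = g u" "0 \<le> u"
    "\<And>i. i < length vs - 1 \<Longrightarrow> closed_segment (vs ! i) (vs ! Suc i) \<subseteq> g ` {0..u}"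
    "ennreal (\<Sum>i<length vs - 1. dist (vs ! i) (vs ! Suc i)) \<le> arc_length g 0 u"
proof -
  obtain \<tau> where \<tau>: "\<tau> 0 = 0" "\<tau> (length vs - 1) = u" "\<And>i. i < length vs \<Longrightarrow> g (\<tau> i) = vs ! i"
    "\<And>i. i < length vs - 1 \<Longrightarrow> \<tau> i \<le> \<tau> (Suc i)"
    "\<And>i. i < length vs - 1 \<Longrightarrow> g ` {\<tau> i..\<tau> (Suc i)} = closed_segment (vs ! i) (vs ! Suc i)"
    using assms(1) unfolding runs_along_def by blast
  show "vs ! 0 = g 0" "last vs = g u"
    using \<tau>(1,2) \<tau>(3)[of 0] \<tau>(3)[of "length vs - 1"] assms(2) by (simp_all add: last_conv_nth)
  have mono: "\<tau> i \<le> \<tau> j" if "i \<le> j" "j \<le> length vs - 1" for i j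
    using that
  proof (induction j rule: dec_induct)
    case (step j)
    then show ?case using \<tau>(4)[of j] by simp
  qed simp
  show "0 \<le> u"
    using mono[of 0 "length vs - 1"] \<tau>(1,2) by simp
  show "closed_segment (vs ! i) (vs ! Suc i) \<subseteq> g ` {0..u}" if "i < length vs - 1" for i
  proof -
    have "{\<tau> i..\<tau> (Suc i)} \<subseteq> {0..u}"
      using mono[of 0 i] mono[of "Suc i" "length vs - 1"] that \<tau>(1,2) by auto
    then show ?thesis
      unfolding \<tau>(5)[OF that, symmetric] by (rule image_mono)
  qed
  have "ennreal (\<Sum>i<n. dist (vs ! i) (vs ! Suc i)) \<le> arc_length g 0 (\<tau> n)" if "n \<le> length vs - 1" for n
    using that
  proof (induction n)
    case (Suc n)
    have "ennreal (\<Sum>i<Suc n. dist (vs ! i) (vs ! Suc i))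
        = ennreal (\<Sum>i<n. dist (vs ! i) (vs ! Suc i)) + ennreal (dist (g (\<tau> n)) (g (\<tau> (Suc n))))"
      using Suc.prems \<tau>(3)[of n] \<tau>(3)[of "Suc n"] by (simp add: ennreal_plus sum_nonneg)
    also have "\<dots> \<le> arc_length g 0 (\<tau> n) + arc_length g (\<tau> n) (\<tau> (Suc n))"
      using Suc \<tau>(4)[of n] by (intro add_mono dist_le_arc_length) simp_all
    also have "\<dots> = arc_length g 0 (\<tau> (Suc n))"
      using mono[of 0 n] Suc.prems \<tau>(1) \<tau>(4)[of n] by (intro arc_length_add[symmetric]) simp_all
    finally show ?case .
  qed simp
  from this[of "length vs - 1"]
  show "ennreal (\<Sum>i<length vs - 1. dist (vs ! i) (vs ! Suc i)) \<le> arc_length g 0 u"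
    using \<tau>(2) by simp
qed

lemma walk_mono:
  assumes "walk vs t f" "i \<le> j" "j \<le> length vs - 1"
  shows "t i \<le> t j"
  using assms(2,3)
proof (induction j rule: dec_induct)
  case (step j)
  then have "t j < t (Suc j)"
    using assms(1) by (simp add: walk_def)
  then show ?case using step by simp
qed simp

lemma dist_le_in_closed_segment:
  fixes x y :: complex
  assumes "x \<in> closed_segment a b" "y \<in> closed_segment a b"
  shows "norm (x - y) \<le> dist a b"
proof -
  have "norm (x - y) \<le> norm (x - a) \<or> norm (x - y) \<le> norm (x - b)"
    using segment_furthest_le[OF assms(2), of x] by auto
  then show ?thesis
    using segment_bound[OF assms(1)] by (auto simp: dist_norm norm_minus_commute)
qed

lemma walk_part:
  assumes "walk vs t f" "i < length vs - 1"
  shows "f ` {t i..min (t (Suc i)) T} \<subseteq> closed_segment (vs ! i) (vs ! Suc i)"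
    "bounded (f ` {t i..min (t (Suc i)) T})"
    "0 \<le> diameter (f ` {t i..min (t (Suc i)) T})"
proof -
  have "f ` {t i..t (Suc i)} \<subseteq> closed_segment (vs ! i) (vs ! Suc i)"
    using assms by (simp add: walk_def)
  moreover have "f ` {t i..min (t (Suc i)) T} \<subseteq> f ` {t i..t (Suc i)}"
    by (intro image_mono) auto
  ultimately show "f ` {t i..min (t (Suc i)) T} \<subseteq> closed_segment (vs ! i) (vs ! Suc i)"
    by blast
  then show "bounded (f ` {t i..min (t (Suc i)) T})"
    using bounded_closed_segment bounded_subset by blast
  then show "0 \<le> diameter (f ` {t i..min (t (Suc i)) T})"
    by (rule diameter_ge_0)
qed

lemma trajectory_length_nonneg: "walk vs t f \<Longrightarrow> 0 \<le> trajectory_length vs t f T"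
  unfolding trajectory_length_def by (intro sum_nonneg) (simp add: walk_part)

lemma trajectory_length_le:
  assumes "walk vs t f"
  shows "trajectory_length vs t f T \<le> (\<Sum>i<length vs - 1. dist (vs ! i) (vs ! Suc i))"
  unfolding trajectory_length_def
proof (rule sum_mono)
  fix i assume "i \<in> {..<length vs - 1}"
  then have "f ` {t i..min (t (Suc i)) T} \<subseteq> closed_segment (vs ! i) (vs ! Suc i)"
    using walk_part(1)[OF assms] by simp
  then show "diameter (f ` {t i..min (t (Suc i)) T}) \<le> dist (vs ! i) (vs ! Suc i)"
    by (intro diameter_le) (auto intro: dist_le_in_closed_segment)
qed

lemma intrinsic_dist_polyline:
  assumes "\<And>i. i < n \<Longrightarrow> closed_segment (vs ! i) (vs ! Suc i) \<subseteq> P" "vs ! 0 \<in> P"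
  shows "intrinsic_dist P (vs ! 0) (vs ! n) \<le> ennreal (\<Sum>i<n. dist (vs ! i) (vs ! Suc i))"
  using assms(1)
proof (induction n)
  case 0
  then show ?case
    using intrinsic_dist_segment[of "vs ! 0" "vs ! 0" P] assms(2) by simp
next
  case (Suc n)
  have "intrinsic_dist P (vs ! 0) (vs ! Suc n)
      \<le> intrinsic_dist P (vs ! 0) (vs ! n) + intrinsic_dist P (vs ! n) (vs ! Suc n)"
    by (rule intrinsic_dist_triangle)
  also have "\<dots> \<le> ennreal (\<Sum>i<n. dist (vs ! i) (vs ! Suc i)) + ennreal (dist (vs ! n) (vs ! Suc n))"
    using Suc by (intro add_mono intrinsic_dist_segment) simp_all
  also have "\<dots> = ennreal (\<Sum>i<Suc n. dist (vs ! i) (vs ! Suc i))"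
    by (simp add: ennreal_plus sum_nonneg)
  finally show ?case .
qed

text \<open>The visited parts of the route connect its start to \<open>f s\<close>. A completed
  segment contributes at least its length, the current one at least the distance from its first
  vertex, however much the agent goes back and forth.\<close>

lemma intrinsic_dist_le_trajectory_length:
  assumes w: "walk vs t f" and "vs \<noteq> []" "0 \<le> s"
    and P: "\<And>i. i < length vs - 1 \<Longrightarrow> closed_segment (vs ! i) (vs ! Suc i) \<subseteq> P" "vs ! 0 \<in> P"
  shows "intrinsic_dist P (vs ! 0) (f s) \<le> ennreal (trajectory_length vs t f s)"
proof -
  define N where "N = length vs - 1"
  define d where "d i = diameter (f ` {t i..min (t (Suc i)) s})" for i
  have d0: "0 \<le> d i" if "i < N" for i
    using that walk_part(3)[OF w] by (simp add: d_def N_def)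
  have full: "dist (vs ! i) (vs ! Suc i) \<le> d i" if "i < N" "t (Suc i) \<le> s" for i
  proof -
    have "f (t i) = vs ! i" "f (t (Suc i)) = vs ! Suc i" "t i < t (Suc i)"
      using w that by (simp_all add: walk_def N_def)
    moreover from this(3) that(2) have "t i \<in> {t i..min (t (Suc i)) s}" "t (Suc i) \<in> {t i..min (t (Suc i)) s}"
      by auto
    ultimately have "vs ! i \<in> f ` {t i..min (t (Suc i)) s}" "vs ! Suc i \<in> f ` {t i..min (t (Suc i)) s}"
      by (metis imageI)+
    then show ?thesis
      unfolding d_def using walk_part(2)[OF w] that(1)
      by (intro diameter_bounded_bound) (simp_all add: N_def)
  qed
  have full_sum: "(\<Sum>i<j. dist (vs ! i) (vs ! Suc i)) \<le> (\<Sum>i<j. d i)" if "j \<le> N" "t j \<le> s" for j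
  proof (rule sum_mono)
    fix i assume "i \<in> {..<j}"
    then show "dist (vs ! i) (vs ! Suc i) \<le> d i"
      using full[of i] walk_mono[OF w, of "Suc i" j] that by (simp add: N_def)
  qed
  have traj: "trajectory_length vs t f s = (\<Sum>i<N. d i)"
    by (simp add: trajectory_length_def d_def N_def)
  show ?thesis
  proof (cases "t N \<le> s")
    case True
    then have "f s = vs ! N"
      using w \<open>vs \<noteq> []\<close> by (simp add: walk_def N_def last_conv_nth)
    then show ?thesis
      using intrinsic_dist_polyline[of N vs P] P full_sum[OF order_refl True]
      by (auto simp: traj N_def intro: order_trans ennreal_leI)
  next
    case False
    \<comment> \<open>Finds the segment on which the agent is at time \<open>s\<close>.\<close>
    have interval: "\<exists>j<n. t j \<le> s \<and> s < t (Suc j)" if "s < t n" for n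
      using that
    proof (induction n)
      case 0
      then show ?case
        using w \<open>0 \<le> s\<close> by (simp add: walk_def)
    next
      case (Suc n)
      then show ?case
        by (cases "s < t n") (auto simp: less_Suc_eq)
    qed
    obtain j where j: "j < N" "t j \<le> s" "s < t (Suc j)"
      using interval[of N] False by (auto simp: not_le)
    have mem: "vs ! j \<in> f ` {t j..min (t (Suc j)) s}" "f s \<in> f ` {t j..min (t (Suc j)) s}"
      using w j by (auto simp: walk_def N_def intro!: image_eqI[of _ f "t j"])
    then have "dist (vs ! j) (f s) \<le> d j"
      unfolding d_def using walk_part(2)[OF w] j(1) by (intro diameter_bounded_bound) (simp_all add: N_def)
    moreover have "f s \<in> closed_segment (vs ! j) (vs ! Suc j)"
      using walk_part(1)[OF w] mem(2) j(1) unfolding N_def by blast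
    then have "closed_segment (vs ! j) (f s) \<subseteq> P"
      using P(1)[of j] j(1) closed_segment_subset[OF _ _ convex_closed_segment]
      by (metis N_def ends_in_segment(1) subset_trans)
    ultimately have last: "intrinsic_dist P (vs ! j) (f s) \<le> ennreal (d j)"
      using intrinsic_dist_segment ennreal_leI order_trans by blast
    have "intrinsic_dist P (vs ! 0) (f s)
        \<le> intrinsic_dist P (vs ! 0) (vs ! j) + intrinsic_dist P (vs ! j) (f s)"
      by (rule intrinsic_dist_triangle)
    also have "\<dots> \<le> ennreal (\<Sum>i<j. d i) + ennreal (d j)"
    proof (rule add_mono[OF _ last])
      have "intrinsic_dist P (vs ! 0) (vs ! j) \<le> ennreal (\<Sum>i<j. dist (vs ! i) (vs ! Suc i))"
        using P j by (intro intrinsic_dist_polyline) (simp_all add: N_def)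
      also have "\<dots> \<le> ennreal (\<Sum>i<j. d i)"
        using full_sum[of j] j by (intro ennreal_leI) simp
      finally show "intrinsic_dist P (vs ! 0) (vs ! j) \<le> ennreal (\<Sum>i<j. d i)" .
    qed
    also have "\<dots> = ennreal (\<Sum>i<Suc j. d i)"
      using d0[OF j(1)] sum_nonneg[of "{..<j}" d] d0 j(1) by (simp add: ennreal_plus)
    \<comment> \<open>Segments not yet entered contribute nonnegative terms.\<close>
    also have "\<dots> \<le> ennreal (\<Sum>i<N. d i)"
      using d0 j(1) by (intro ennreal_leI sum_mono2) auto
    finally show ?thesis
      by (simp add: traj)
  qed
qed

lemma walk_continuous_on:
  assumes w: "walk vs t f"
  shows "continuous_on {0..M} f"
proof -
  have "continuous_on {0..t n} f" if "n \<le> length vs - 1" for n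
    using that
  proof (induction n)
    case 0
    then show ?case using w by (simp add: walk_def)
  next
    case (Suc n)
    have "continuous_on {t n..t (Suc n)} f"
      using w Suc.prems by (simp add: walk_def)
    then have "continuous_on ({0..t n} \<union> {t n..t (Suc n)}) f"
      using Suc by (intro continuous_on_closed_Un) auto
    moreover have "{0..t n} \<union> {t n..t (Suc n)} = {0..t (Suc n)}"
      using walk_mono[OF w, of 0 n] walk_mono[OF w, of n "Suc n"] Suc.prems w
      by (intro ivl_disj_un_two_touch) (simp_all add: walk_def)
    ultimately show ?case by simp
  qed
  moreover have "continuous_on {t (length vs - 1)..} f"
    by (rule continuous_on_eq[OF continuous_on_const[of _ "last vs"]]) (use w in \<open>simp add: walk_def\<close>)
  ultimately have "continuous_on ({0..t (length vs - 1)} \<union> {t (length vs - 1)..}) f"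
    by (intro continuous_on_closed_Un) auto
  then show ?thesis
    by (rule continuous_on_subset) auto
qed

text \<open>The meeting times up to \<open>T\<close> form a nonempty compact set, whose minimum is
  the rendezvous.\<close>

lemma first_meeting:
  assumes w: "walk vs1 t1 f1" "walk vs2 t2 f2" and "meet_at f1 f2 T"
  shows "\<exists>T. rendezvous_at f1 f2 T"
proof -
  define S where "S = {s \<in> {0..T}. f1 s - f2 s = 0}"
  have "closed S"
    unfolding S_def using walk_continuous_on[OF w(1), of T] walk_continuous_on[OF w(2), of T]
    by (intro continuous_closed_preimage_constant continuous_on_diff) auto
  then have "compact S"
    by (auto simp: compact_eq_bounded_closed S_def intro: bounded_subset[of "{0..T}"])
  moreover have "T \<in> S"
    using assms(3) by (simp add: S_def meet_at_def)
  ultimately obtain T0 where T0: "T0 \<in> S" "\<And>s. s \<in> S \<Longrightarrow> T0 \<le> s"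
    using compact_attains_inf[of S] by blast
  have "\<not> meet_at f1 f2 s" if "s < T0" for s
    using T0(1) T0(2)[of s] that by (auto simp: S_def meet_at_def)
  then show ?thesis
    using T0(1) by (intro exI[of _ T0]) (simp add: rendezvous_at_def meet_at_def S_def)
qed

text \<open>The walk spends one unit of time on each segment. It is needed to know that
  \<open>cost\<close> is a supremum over at least one run.\<close>

lemma walk_exists:
  assumes "vs \<noteq> []"
  shows "\<exists>t f. walk vs t f"
proof -
  define N where "N = length vs - 1"
  define f where "f s = (if real N \<le> s then last vs
    else linepath (vs ! nat \<lfloor>s\<rfloor>) (vs ! Suc (nat \<lfloor>s\<rfloor>)) (s - real (nat \<lfloor>s\<rfloor>)))" for s
  have f_at: "f (real i) = vs ! i" if "i \<le> N" for i
    using that assms by (auto simp: f_def N_def last_conv_nth linepath_0')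
  have f: "f s = linepath (vs ! i) (vs ! Suc i) (s - real i)"
    if "i < N" "s \<in> {real i..real (Suc i)}" for i s
  proof (cases "s = real (Suc i)")
    \<comment> \<open>At the right end of the interval the floor already belongs to the next
      segment, or the walk is over; the value is the common vertex in either case.\<close>
    case True
    then show ?thesis
      using f_at[of "Suc i"] that(1) by (simp add: linepath_1')
  next
    case False
    then have "\<lfloor>s\<rfloor> = int i" "s < real N"
      using that by (auto simp: floor_eq_iff)
    then show ?thesis
      by (simp add: f_def)
  qed
  have "walk vs real f"
    unfolding walk_def
  proof (intro conjI allI impI)
    fix i assume i: "i < length vs - 1"
    then have iN: "i < N" by (simp add: N_def)
    have "continuous_on {real i..real (Suc i)} (\<lambda>s. linepath (vs ! i) (vs ! Suc i) (s - real i))"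
      unfolding linepath_def by (intro continuous_intros)
    then show "continuous_on {real i..real (Suc i)} f"
      using f[OF iN] continuous_on_cong by (metis (no_types, lifting))
    show "f ` {real i..real (Suc i)} \<subseteq> closed_segment (vs ! i) (vs ! Suc i)"
      using f[OF iN] by (auto simp: linepath_in_path)
    show "f (real i) = vs ! i" "f (real (Suc i)) = vs ! Suc i"
      using iN by (intro f_at; simp)+
  qed (simp_all add: f_def N_def)
  then show ?thesis by blast
qed

section \<open>Rendezvous and cost of RVM\<close>

lemma RVM_walk:
  assumes P: "terrain P" and pq: "p \<in> P" "q \<in> P" and c: "c \<noteq> 0"
    and w: "walk (agent_route RVM P c p q) t f"
  obtains g u T0 where "shortest_path P p q g" "u \<in> {0..1}"
    "path_length (subpath 0 u g) = path_length g / 2"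
    "\<And>s. s \<ge> T0 \<Longrightarrow> f s = g u"
    "\<And>T. ennreal (trajectory_length (agent_route RVM P c p q) t f T) \<le> intrinsic_dist P p q / 2"
    "\<And>s. s \<ge> 0 \<Longrightarrow>
      intrinsic_dist P p (f s) \<le> ennreal (trajectory_length (agent_route RVM P c p q) t f s)"
proof -
  let ?vs = "agent_route RVM P c p q"
  obtain g u where g: "shortest_path P p q g" and u: "u \<in> {0..1}"
    "path_length (subpath 0 u g) = path_length g / 2" "runs_along ?vs g u"
    using agent_route_RVM[OF P pq c] unfolding runs_to_midpoint_def by blast
  interpret terrain_shortest P p q g
    using P pq g by unfold_locales
  have ne: "?vs \<noteq> []"
    unfolding agent_route_def using route_eq_Cons by (metis list.discI)
  note poly = runs_along_polyline[OF u(3) ne]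
  have seg: "closed_segment (?vs ! i) (?vs ! Suc i) \<subseteq> P" if "i < length ?vs - 1" for i
    using poly(4)[OF that] g_path(5) u(1) by fastforce
  show ?thesis
  proof (rule that[OF g u(1,2)])
    show "f s = g u" if "s \<ge> t (length ?vs - 1)" for s
      using w poly(2) that by (simp add: walk_def)
    show "ennreal (trajectory_length ?vs t f T) \<le> intrinsic_dist P p q / 2" for T
    proof -
      have "ennreal (trajectory_length ?vs t f T) \<le> arc_length g 0 u"
        using ennreal_leI[OF trajectory_length_le[OF w]] poly(5) by (rule order_trans)
      then show ?thesis
        using u path_length_shortest_path[OF g] by (simp add: path_length_subpath)
    qed
    show "intrinsic_dist P p (f s) \<le> ennreal (trajectory_length ?vs t f s)" if "s \<ge> 0" for s
      using intrinsic_dist_le_trajectory_length[OF w ne that seg] poly(1) g_path(2) pq by simp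
  qed
qed

lemma RVM_guarantees_rendezvous:
  assumes "initial_positions P p q"
  shows "guarantees_rendezvous RVM P p q"
  unfolding guarantees_rendezvous_def adversary_choice_def
proof (intro allI impI, elim conjE)
  fix c1 c2 t1 f1 t2 f2
  assume c: "c1 \<noteq> 0" "c2 \<noteq> 0"
    and w: "walk (agent_route RVM P c1 p q) t1 f1" "walk (agent_route RVM P c2 q p) t2 f2"
  have P: "terrain P" and pq: "p \<in> P" "q \<in> P"
    using assms by (simp_all add: initial_positions_def)
  obtain g1 u1 T1 where 1: "shortest_path P p q g1" "u1 \<in> {0..1}"
    "path_length (subpath 0 u1 g1) = path_length g1 / 2" "\<And>s. s \<ge> T1 \<Longrightarrow> f1 s = g1 u1"
    using RVM_walk[OF P pq c(1) w(1)] by metis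
  obtain g2 u2 T2 where 2: "shortest_path P q p g2" "u2 \<in> {0..1}"
    "path_length (subpath 0 u2 g2) = path_length g2 / 2" "\<And>s. s \<ge> T2 \<Longrightarrow> f2 s = g2 u2"
    using RVM_walk[OF P pq(2,1) c(2) w(2)] by metis
  have "g1 u1 = g2 u2"
    using midpoint_unique[OF P pq 1(1) 2(1) 1(2,3) 2(2,3)] .
  \<comment> \<open>Both agents are inert by then; the maximum with 0 is there because meeting times
    must be nonnegative.\<close>
  then have "meet_at f1 f2 (max 0 (max T1 T2))"
    using 1(4) 2(4) by (simp add: meet_at_def)
  then show "\<exists>T. meet_at f1 f2 T" ..
qed

text \<open>The sum does not depend on the adversary, so every element of the set in
  \<open>cost\<close> equals \<open>D\<close>, and only its nonemptiness remains to be
  shown.\<close>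

lemma RVM_trajectories:
  assumes "initial_positions P p q" and choice: "adversary_choice RVM P p q c1 c2 t1 f1 t2 f2"
    and T: "rendezvous_at f1 f2 T"
  shows "ennreal (trajectory_length (agent_route RVM P c1 p q) t1 f1 T +
    trajectory_length (agent_route RVM P c2 q p) t2 f2 T) = terrain_dist P p q"
proof -
  have P: "terrain P" and pq: "p \<in> P" "q \<in> P"
    using assms by (simp_all add: initial_positions_def)
  have c: "c1 \<noteq> 0" "c2 \<noteq> 0"
    and w: "walk (agent_route RVM P c1 p q) t1 f1" "walk (agent_route RVM P c2 q p) t2 f2"
    using choice by (simp_all add: adversary_choice_def)
  define l1 l2 where "l1 = trajectory_length (agent_route RVM P c1 p q) t1 f1 T"
    and "l2 = trajectory_length (agent_route RVM P c2 q p) t2 f2 T"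
  have T': "0 \<le> T" "f1 T = f2 T"
    using T by (simp_all add: rendezvous_at_def meet_at_def)
  have 1: "ennreal l1 \<le> intrinsic_dist P p q / 2" "intrinsic_dist P p (f1 T) \<le> ennreal l1"
    using RVM_walk[OF P pq c(1) w(1)] T'(1) unfolding l1_def by metis+
  have 2: "ennreal l2 \<le> intrinsic_dist P q p / 2" "intrinsic_dist P q (f2 T) \<le> ennreal l2"
    using RVM_walk[OF P pq(2,1) c(2) w(2)] T'(1) unfolding l2_def by metis+
  have "ennreal (l1 + l2) = ennreal l1 + ennreal l2"
    using trajectory_length_nonneg[OF w(1)] trajectory_length_nonneg[OF w(2)]
    by (simp add: l1_def l2_def ennreal_plus)
  also have "\<dots> = intrinsic_dist P p q"
  proof (rule antisym)
    show "ennreal l1 + ennreal l2 \<le> intrinsic_dist P p q"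
      using add_mono[OF 1(1) 2(1)]
      by (simp add: intrinsic_dist_commute[of P q p] ennreal_half_plus_half)
    have "intrinsic_dist P p q \<le> intrinsic_dist P p (f1 T) + intrinsic_dist P (f1 T) q"
      by (rule intrinsic_dist_triangle)
    also have "\<dots> \<le> ennreal l1 + ennreal l2"
      using 1(2) 2(2) T'(2) by (simp add: add_mono intrinsic_dist_commute[of P _ q])
    finally show "intrinsic_dist P p q \<le> ennreal l1 + ennreal l2" .
  qed
  finally show ?thesis
    by (simp add: terrain_dist_eq[OF P pq] l1_def l2_def)
qed

theorem theorem2p2:
  fixes P :: "complex set" and p q :: complex and D :: ennreal
  assumes "initial_positions P p q"
    and "D = terrain_dist P p q"
  shows "guarantees_rendezvous RVM P p q \<and> cost RVM D = D"
proof
  show meet: "guarantees_rendezvous RVM P p q"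
    using assms(1) by (rule RVM_guarantees_rendezvous)
  \<comment> \<open>A concrete run with unit 1 for both agents; the supremum of the empty set would
    be 0.\<close>
  have "agent_route RVM P 1 a b \<noteq> []" for a b
    unfolding agent_route_def using route_eq_Cons by (metis list.discI)
  then obtain t1 f1 t2 f2 where
    w: "walk (agent_route RVM P 1 p q) t1 f1" "walk (agent_route RVM P 1 q p) t2 f2"
    using walk_exists by metis
  then have choice: "adversary_choice RVM P p q 1 1 t1 f1 t2 f2"
    by (simp add: adversary_choice_def)
  then obtain T where T: "rendezvous_at f1 f2 T"
    using meet first_meeting[OF w] unfolding guarantees_rendezvous_def by blast
  show "cost RVM D = D"
    unfolding cost_def
  proof (rule antisym)
    show "D \<le> Sup {ennreal (trajectory_length (agent_route RVM P c1 p q) t1 f1 T +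
                   trajectory_length (agent_route RVM P c2 q p) t2 f2 T)
          | P p q c1 c2 t1 f1 t2 f2 T.
            initial_positions P p q \<and> terrain_dist P p q = D \<and>
            adversary_choice RVM P p q c1 c2 t1 f1 t2 f2 \<and> rendezvous_at f1 f2 T}"
      using RVM_trajectories[OF assms(1) choice T] assms choice T
      by (intro Sup_upper) force
  qed (rule Sup_least, use RVM_trajectories in force)
qed

end
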